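(* Let $F$ be any free group (possibly of infinite rank) and let $g_1,\ldots,g_n \in F$ be a finite sequence such that the chain $\sum_{i} g_i \in C_1(F)$ is a $1$-boundary, i.e. $\sum_i g_i\in B_1(F)$. Then either $\sum_i g_i$ is the zero chain in $\overline{C}_1(F)$, in which case $\operatorname{scl}\left(\sum_i g_i\right) = 0$, or $\operatorname{scl}\left(\sum_i g_i\right) \ge 1/8$.
   Context: Let $G$ be a group. $C_n(G)$ is the real vector space freely generated by $n$-tuples of elements of $G$. The space of real $1$-boundaries is $B_1(G)=\partial C_2(G)\subset C_1(G)$, where $\partial: C_2(G)\to C_1(G)$ is the linear (inhomogeneous bar complex) boundary map with $\partial(g,h) = g - gh + h$. $\overline{C}_1(G)$ is the quotient of $C_1(G)$ by the subspace spanned by all elements of the form $g^n - n g$ and $g - hgh^{-1}$, with $g,h\in G$, $n\in\mathbf{Z}$; here $g^n$ is the basis element of $C_1(G)$ given by the group element $g^n$ and $ng$ is $n$ times the basis element $g$. $\overline{B}_1(G)$ is the image of $B_1(G)$ in $\overline{C}_1(G)$. A function $\Phi: G\to\mathbf{R}$ is a quasimorphism if there is $D\ge 0$ with $|\Phi(gh)-\Phi(g)-\Phi(h)|\le D$ for all $g,h\in G$; the infimum of such $D$ is the defect $D_\Phi$. A quasimorphism is homogeneous if it restricts to a homomorphism on every cyclic subgroup, i.e. $\Phi(g^n)=n\Phi(g)$ for all $g \in G$, $n\in\mathbf{Z}$; homogeneous quasimorphisms are constant on conjugacy classes. The stable commutator length of a chain $\sum_i r_i g_i$ representing an element of $\overline{B}_1(G)$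 is defined (via generalized Bavard duality) by $$\operatorname{scl}\Big(\sum_i r_i g_i\Big)=\sup_\phi \frac{\sum_i r_i\phi(g_i)}{2D_\phi},$$ where $\phi$ ranges over all homogeneous quasimorphisms on $G$. Those with $D_\phi=0$ are homomorphisms, which vanish on $1$-boundaries, and are ignored in the supremum; the supremum is taken to be $0$ if there is no homogeneous quasimorphism with $D_\phi>0$. *)

theory Defs
  imports "HOL-Analysis.Finite_Function_Topology" "HOL-Algebra.Group"
begin

section \<open>Free groups\<close>

text \<open>A letter \<open>(s, True)\<close> stands for \<open>s\<close> and \<open>(s, False)\<close> for its inverse. A group is free on
  \<open>S\<close> if every element is the value of exactly one reduced word in the letters from \<open>S\<close> and
  their inverses; \<open>S\<close> is an arbitrary, possibly infinite, subset.\<close>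

type_synonym 'a letter = "'a \<times> bool"

definition letter_value :: "('a, 'm) monoid_scheme \<Rightarrow> 'a letter \<Rightarrow> 'a" where
  "letter_value G x = (if snd x then fst x else inv\<^bsub>G\<^esub> (fst x))"

definition word_value :: "('a, 'm) monoid_scheme \<Rightarrow> 'a letter list \<Rightarrow> 'a" where
  "word_value G w = foldr (\<lambda>x a. letter_value G x \<otimes>\<^bsub>G\<^esub> a) w \<one>\<^bsub>G\<^esub>"

definition reduced_word :: "'a letter list \<Rightarrow> bool" where
  "reduced_word = successively (\<lambda>x y. \<not> (fst x = fst y \<and> snd x \<noteq> snd y))"

definition reduced_words :: "'a set \<Rightarrow> 'a letter list set" where
  "reduced_words S = {w. set w \<subseteq> S \<times> UNIV \<and> reduced_word w}"

definition free_basis :: "('a, 'm) monoid_scheme \<Rightarrow> 'a set \<Rightarrow> bool" where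
  "free_basis G S \<longleftrightarrow> S \<subseteq> carrier G \<and> bij_betw (word_value G) (reduced_words S) (carrier G)"

definition free_group :: "('a, 'm) monoid_scheme \<Rightarrow> bool" where
  "free_group G \<longleftrightarrow> group G \<and> (\<exists>S. free_basis G S)"


section \<open>Real chains and boundaries\<close>

text \<open>The real vector space freely generated by \<open>X\<close> consists of the finitely supported functions
  on the ambient type whose support lies in \<open>X\<close>.\<close>

definition free_vs :: "'x set \<Rightarrow> ('x \<Rightarrow>\<^sub>0 real) set" where
  "free_vs X = {c. Poly_Mapping.keys c \<subseteq> X}"

definition gen :: "'x \<Rightarrow> 'x \<Rightarrow>\<^sub>0 real" where
  "gen x = Poly_Mapping.single x 1"

definition C1 :: "('a, 'm) monoid_scheme \<Rightarrow> ('a \<Rightarrow>\<^sub>0 real) set" where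
  "C1 G = free_vs (carrier G)"

definition C2 :: "('a, 'm) monoid_scheme \<Rightarrow> ('a \<times> 'a \<Rightarrow>\<^sub>0 real) set" where
  "C2 G = free_vs (carrier G \<times> carrier G)"

definition bar_boundary ::
    "('a, 'm) monoid_scheme \<Rightarrow> ('a \<times> 'a \<Rightarrow>\<^sub>0 real) \<Rightarrow> 'a \<Rightarrow>\<^sub>0 real" where
  "bar_boundary G c = (\<Sum>(g, h) \<in> Poly_Mapping.keys c.
     Poly_Mapping.lookup c (g, h) *\<^sub>R (gen g - gen (g \<otimes>\<^bsub>G\<^esub> h) + gen h))"

definition B1 :: "('a, 'm) monoid_scheme \<Rightarrow> ('a \<Rightarrow>\<^sub>0 real) set" where
  "B1 G = bar_boundary G ` C2 G"

definition homogenizing_subspace :: "('a, 'm) monoid_scheme \<Rightarrow> ('a \<Rightarrow>\<^sub>0 real) set" where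
  "homogenizing_subspace G = span
     ({gen (g [^]\<^bsub>G\<^esub> n) - of_int n *\<^sub>R gen g | g n. g \<in> carrier G \<and> n \<in> (UNIV :: int set)} \<union>
      {gen g - gen (h \<otimes>\<^bsub>G\<^esub> g \<otimes>\<^bsub>G\<^esub> inv\<^bsub>G\<^esub> h) | g h. g \<in> carrier G \<and> h \<in> carrier G})"

text \<open>The image of a chain in the quotient of \<open>C1 G\<close> by this subspace, as a coset. The zero
  element of the quotient is \<open>C1bar_class G 0\<close>.\<close>

definition C1bar_class :: "('a, 'm) monoid_scheme \<Rightarrow> ('a \<Rightarrow>\<^sub>0 real) \<Rightarrow> ('a \<Rightarrow>\<^sub>0 real) set" where
  "C1bar_class G c = (\<lambda>x. c + x) ` homogenizing_subspace G"


section \<open>Quasimorphisms and stable commutator length\<close>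

text \<open>Functions on \<open>G\<close> are total functions on the ambient type; their values outside
  \<open>carrier G\<close> play no role.\<close>

definition defect_bounds :: "('a, 'm) monoid_scheme \<Rightarrow> ('a \<Rightarrow> real) \<Rightarrow> real set" where
  "defect_bounds G \<phi> =
     {D. D \<ge> 0 \<and> (\<forall>g\<in>carrier G. \<forall>h\<in>carrier G. \<bar>\<phi> (g \<otimes>\<^bsub>G\<^esub> h) - \<phi> g - \<phi> h\<bar> \<le> D)}"

definition quasimorphism :: "('a, 'm) monoid_scheme \<Rightarrow> ('a \<Rightarrow> real) \<Rightarrow> bool" where
  "quasimorphism G \<phi> \<longleftrightarrow> defect_bounds G \<phi> \<noteq> {}"

definition defect :: "('a, 'm) monoid_scheme \<Rightarrow> ('a \<Rightarrow> real) \<Rightarrow> real" where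
  "defect G \<phi> = Inf (defect_bounds G \<phi>)"

definition homogeneous_quasimorphism :: "('a, 'm) monoid_scheme \<Rightarrow> ('a \<Rightarrow> real) \<Rightarrow> bool" where
  "homogeneous_quasimorphism G \<phi> \<longleftrightarrow> quasimorphism G \<phi> \<and>
     (\<forall>g\<in>carrier G. \<forall>n::int. \<phi> (g [^]\<^bsub>G\<^esub> n) = of_int n * \<phi> g)"

definition chain_eval :: "('a \<Rightarrow> real) \<Rightarrow> ('a \<Rightarrow>\<^sub>0 real) \<Rightarrow> real" where
  "chain_eval \<phi> c = (\<Sum>g \<in> Poly_Mapping.keys c. Poly_Mapping.lookup c g * \<phi> g)"

text \<open>This is meaningful for chains whose class lies in the image of \<open>B1 G\<close>, where the
  supremum is finite; see \<open>bdd_above_scl\<close> below.\<close>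

definition scl :: "('a, 'm) monoid_scheme \<Rightarrow> ('a \<Rightarrow>\<^sub>0 real) \<Rightarrow> real" where
  "scl G c =
     (let Q = {\<phi>. homogeneous_quasimorphism G \<phi> \<and> defect G \<phi> > 0} in
      if Q = {} then 0 else (SUP \<phi>\<in>Q. chain_eval \<phi> c / (2 * defect G \<phi>)))"


section \<open>Sanity checks\<close>

lemma chain_eval_superset:
  assumes "finite A" "Poly_Mapping.keys c \<subseteq> A"
  shows "chain_eval \<phi> c = (\<Sum>g\<in>A. Poly_Mapping.lookup c g * \<phi> g)"
  unfolding chain_eval_def
  by (rule sum.mono_neutral_left) (use assms in \<open>auto simp: in_keys_iff\<close>)

lemma chain_eval_zero: "chain_eval \<phi> 0 = 0"
  by (simp add: chain_eval_def)

lemma chain_eval_gen: "chain_eval \<phi> (gen g) = \<phi> g"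
  by (simp add: chain_eval_def gen_def)

lemma lookup_scaleR_real:
  "Poly_Mapping.lookup (r *\<^sub>R c) g = r * Poly_Mapping.lookup (c :: 'a \<Rightarrow>\<^sub>0 real) g"
  by (simp add: scaleR_poly_mapping_def Abs_poly_mapping_inverse
      finite_subset[OF _ finite_keys[of c]] Collect_mono keys.rep_eq)

lemma chain_eval_add: "chain_eval \<phi> (c + d) = chain_eval \<phi> c + chain_eval \<phi> d"
proof -
  let ?A = "Poly_Mapping.keys c \<union> Poly_Mapping.keys d"
  show ?thesis
    using Poly_Mapping.keys_add[of c d]
    by (simp add: chain_eval_superset[of ?A] lookup_add distrib_right sum.distrib)
qed

lemma chain_eval_scaleR: "chain_eval \<phi> (r *\<^sub>R c) = r * chain_eval \<phi> c"
proof -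
  have "Poly_Mapping.keys (r *\<^sub>R c) \<subseteq> Poly_Mapping.keys c"
    by (auto simp: in_keys_iff lookup_scaleR_real)
  then show ?thesis
    by (simp add: chain_eval_superset[of "Poly_Mapping.keys c"] lookup_scaleR_real
        sum_distrib_left mult.assoc)
qed

lemma linear_chain_eval: "linear (chain_eval \<phi>)"
  by (rule linearI) (simp_all add: chain_eval_add chain_eval_scaleR)

lemma defect_bound:
  assumes "quasimorphism G \<phi>" "g \<in> carrier G" "h \<in> carrier G"
  shows "\<bar>\<phi> (g \<otimes>\<^bsub>G\<^esub> h) - \<phi> g - \<phi> h\<bar> \<le> defect G \<phi>"
  unfolding defect_def
  by (rule cInf_greatest) (use assms in \<open>auto simp: quasimorphism_def defect_bounds_def\<close>)

lemma homogeneous_quasimorphism_conj: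
  assumes "group G" "homogeneous_quasimorphism G \<phi>" "g \<in> carrier G" "h \<in> carrier G"
  shows "\<phi> (h \<otimes>\<^bsub>G\<^esub> g \<otimes>\<^bsub>G\<^esub> inv\<^bsub>G\<^esub> h) = \<phi> g"
proof -
  interpret group G by fact
  let ?k = "h \<otimes>\<^bsub>G\<^esub> g \<otimes>\<^bsub>G\<^esub> inv\<^bsub>G\<^esub> h"
  define D where "D = defect G \<phi>"
  have qm: "\<bar>\<phi> (a \<otimes>\<^bsub>G\<^esub> b) - \<phi> a - \<phi> b\<bar> \<le> D" if "a \<in> carrier G" "b \<in> carrier G" for a b
    using defect_bound[OF _ that] assms(2) by (auto simp: D_def homogeneous_quasimorphism_def)
  have hom: "\<phi> (a [^]\<^bsub>G\<^esub> n) = real n * \<phi> a" if "a \<in> carrier G" for a and n :: nat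
    using assms(2) that unfolding homogeneous_quasimorphism_def
    by (metis int_pow_int of_int_of_nat_eq)
  have pow: "?k [^]\<^bsub>G\<^esub> n = h \<otimes>\<^bsub>G\<^esub> g [^]\<^bsub>G\<^esub> n \<otimes>\<^bsub>G\<^esub> inv\<^bsub>G\<^esub> h" for n :: nat
  proof (induction n)
    case (Suc n)
    have "inv\<^bsub>G\<^esub> h \<otimes>\<^bsub>G\<^esub> (h \<otimes>\<^bsub>G\<^esub> x) = x" if "x \<in> carrier G" for x
      using that assms(4) by (simp flip: m_assoc)
    with Suc show ?case
      using assms(3,4) by (simp add: m_assoc)
  qed (use assms(3,4) in simp)
  have inv: "\<phi> (inv\<^bsub>G\<^esub> h) = - \<phi> h"
  proof -
    have "\<phi> (h [^]\<^bsub>G\<^esub> (-1 :: int)) = of_int (-1) * \<phi> h"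
      using assms(2,4) unfolding homogeneous_quasimorphism_def by blast
    then show ?thesis
      using assms(4) by (simp add: int_pow_neg)
  qed
  have bound: "real n * \<bar>\<phi> ?k - \<phi> g\<bar> \<le> 2 * D" for n :: nat
  proof -
    have "\<bar>\<phi> (?k [^]\<^bsub>G\<^esub> n) - \<phi> (g [^]\<^bsub>G\<^esub> n)\<bar> \<le> 2 * D"
      using qm[of h "g [^]\<^bsub>G\<^esub> n"] qm[of "h \<otimes>\<^bsub>G\<^esub> g [^]\<^bsub>G\<^esub> n" "inv\<^bsub>G\<^esub> h"] assms(3,4) inv
      unfolding pow by (simp add: abs_le_iff)
    then have "\<bar>real n * (\<phi> ?k - \<phi> g)\<bar> \<le> 2 * D"
      using assms(3,4) by (simp add: hom right_diff_distrib)
    then show ?thesis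
      by (simp add: abs_mult)
  qed
  show ?thesis
  proof (rule ccontr)
    assume "\<phi> ?k \<noteq> \<phi> g"
    then obtain n :: nat where "2 * D < real n * \<bar>\<phi> ?k - \<phi> g\<bar>"
      using reals_Archimedean3[of "\<bar>\<phi> ?k - \<phi> g\<bar>"] by auto
    with bound[of n] show False by simp
  qed
qed

lemma chain_eval_homogenizing_subspace:
  assumes "group G" "homogeneous_quasimorphism G \<phi>" "x \<in> homogenizing_subspace G"
  shows "chain_eval \<phi> x = 0"
  using assms(3) unfolding homogenizing_subspace_def
  by (rule linear_eq_0_on_span[OF linear_chain_eval, rotated])
    (use assms(1,2) in \<open>auto simp: linear_diff[OF linear_chain_eval] chain_eval_gen
       chain_eval_scaleR homogeneous_quasimorphism_def homogeneous_quasimorphism_conj\<close>)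

lemma scl_C1bar_class:
  assumes "group G" "C1bar_class G c = C1bar_class G d"
  shows "scl G c = scl G d"
proof -
  have "0 \<in> homogenizing_subspace G"
    by (simp add: homogenizing_subspace_def span_zero)
  then have "c + 0 \<in> C1bar_class G d"
    using assms(2) unfolding C1bar_class_def by blast
  then obtain x where "x \<in> homogenizing_subspace G" "c = d + x"
    by (auto simp: C1bar_class_def)
  then have "chain_eval \<phi> c = chain_eval \<phi> d" if "homogeneous_quasimorphism G \<phi>" for \<phi>
    using chain_eval_homogenizing_subspace[OF assms(1) that] by (simp add: chain_eval_add)
  then show ?thesis
    unfolding scl_def Let_def by (auto intro!: arg_cong[of _ _ Sup] image_cong)
qed

lemma bdd_above_scl:
  assumes "c \<in> B1 G"
  shows "bdd_above ((\<lambda>\<phi>. chain_eval \<phi> c / (2 * defect G \<phi>)) `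
           {\<phi>. homogeneous_quasimorphism G \<phi> \<and> defect G \<phi> > 0})"
proof -
  obtain d where d: "Poly_Mapping.keys d \<subseteq> carrier G \<times> carrier G" "c = bar_boundary G d"
    using assms by (auto simp: B1_def C2_def free_vs_def)
  define M where "M = (\<Sum>p \<in> Poly_Mapping.keys d. \<bar>Poly_Mapping.lookup d p\<bar>)"
  have "chain_eval \<phi> c / (2 * defect G \<phi>) \<le> M / 2"
    if \<phi>: "homogeneous_quasimorphism G \<phi>" "defect G \<phi> > 0" for \<phi>
  proof -
    have "chain_eval \<phi> c = (\<Sum>(g, h) \<in> Poly_Mapping.keys d.
        Poly_Mapping.lookup d (g, h) * (\<phi> g - \<phi> (g \<otimes>\<^bsub>G\<^esub> h) + \<phi> h))"
      unfolding d(2) bar_boundary_def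
      by (simp add: linear_sum[OF linear_chain_eval] case_prod_unfold chain_eval_scaleR
          chain_eval_add linear_diff[OF linear_chain_eval] chain_eval_gen)
    also have "\<dots> \<le> (\<Sum>p \<in> Poly_Mapping.keys d. \<bar>Poly_Mapping.lookup d p\<bar> * defect G \<phi>)"
    proof (rule sum_mono, clarify)
      fix g h assume "(g, h) \<in> Poly_Mapping.keys d"
      then have "\<bar>\<phi> (g \<otimes>\<^bsub>G\<^esub> h) - \<phi> g - \<phi> h\<bar> \<le> defect G \<phi>"
        using d(1) \<phi>(1) by (intro defect_bound) (auto simp: homogeneous_quasimorphism_def)
      then have "\<bar>\<phi> g - \<phi> (g \<otimes>\<^bsub>G\<^esub> h) + \<phi> h\<bar> \<le> defect G \<phi>"
        by linarith
      then have "\<bar>Poly_Mapping.lookup d (g, h)\<bar> * \<bar>\<phi> g - \<phi> (g \<otimes>\<^bsub>G\<^esub> h) + \<phi> h\<bar>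
          \<le> \<bar>Poly_Mapping.lookup d (g, h)\<bar> * defect G \<phi>"
        by (intro mult_left_mono) auto
      then show "Poly_Mapping.lookup d (g, h) * (\<phi> g - \<phi> (g \<otimes>\<^bsub>G\<^esub> h) + \<phi> h)
          \<le> \<bar>Poly_Mapping.lookup d (g, h)\<bar> * defect G \<phi>"
        by (metis abs_ge_self abs_mult order_trans)
    qed
    also have "\<dots> = M * defect G \<phi>"
      by (simp add: M_def sum_distrib_right)
    finally show ?thesis
      using \<phi>(2) by (simp add: field_simps)
  qed
  then show ?thesis
    by (intro bdd_aboveI[of _ "M / 2"]) auto
qed


text \<open>A group with a free basis in the above sense has the universal property of a free group.\<close>

definition subst_value ::
    "('b, 'm) monoid_scheme \<Rightarrow> ('a \<Rightarrow> 'b) \<Rightarrow> 'a letter list \<Rightarrow> 'b" where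
  "subst_value H f w = word_value H (map (\<lambda>x. (f (fst x), snd x)) w)"

fun push :: "'a letter \<Rightarrow> 'a letter list \<Rightarrow> 'a letter list" where
  "push x [] = [x]"
| "push x (y # w) = (if fst x = fst y \<and> snd x \<noteq> snd y then w else x # y # w)"

definition reduce :: "'a letter list \<Rightarrow> 'a letter list" where
  "reduce w = foldr push w []"

lemma push_reduced_words:
  assumes "w \<in> reduced_words S" "fst x \<in> S"
  shows "push x w \<in> reduced_words S"
  using assms
  by (cases w; cases "tl w") (auto simp: reduced_words_def reduced_word_def mem_Times_iff)

lemma reduce_reduced_words: "set w \<subseteq> S \<times> UNIV \<Longrightarrow> reduce w \<in> reduced_words S"
proof (induction w)
  case Nil
  then show ?case by (simp add: reduce_def reduced_words_def reduced_word_def)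
next
  case (Cons x w)
  then show ?case using push_reduced_words[of "reduce w" S x] by (auto simp: reduce_def)
qed

context
  fixes H :: "('b, 'm) monoid_scheme" and f :: "'a \<Rightarrow> 'b" and S :: "'a set"
  assumes H: "group H" and f: "f ` S \<subseteq> carrier H"
begin

interpretation group H by (fact H)

lemma subst_value_Nil: "subst_value H f [] = \<one>\<^bsub>H\<^esub>"
  by (simp add: subst_value_def word_value_def)

lemma subst_value_Cons:
  "subst_value H f (x # w) = letter_value H (f (fst x), snd x) \<otimes>\<^bsub>H\<^esub> subst_value H f w"
  by (simp add: subst_value_def word_value_def)

lemma subst_letter_closed: "fst x \<in> S \<Longrightarrow> letter_value H (f (fst x), snd x) \<in> carrier H"
  using f by (auto simp: letter_value_def)

lemma subst_value_closed: "set w \<subseteq> S \<times> UNIV \<Longrightarrow> subst_value H f w \<in> carrier H"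
  by (induction w) (auto simp: subst_value_Nil subst_value_Cons intro!: subst_letter_closed)

lemma subst_value_append:
  assumes "set v \<subseteq> S \<times> UNIV" "set w \<subseteq> S \<times> UNIV"
  shows "subst_value H f (v @ w) = subst_value H f v \<otimes>\<^bsub>H\<^esub> subst_value H f w"
  using assms
proof (induction v)
  case Nil
  then show ?case by (simp add: subst_value_Nil subst_value_closed)
next
  case (Cons x v)
  then have "fst x \<in> S" by auto
  with Cons show ?case
    by (simp add: subst_value_Cons m_assoc subst_letter_closed subst_value_closed)
qed

lemma subst_value_push:
  assumes "fst x \<in> S" "set w \<subseteq> S \<times> UNIV"
  shows "subst_value H f (push x w) = subst_value H f (x # w)"
proof (cases w)
  case (Cons y v)
  show ?thesis
  proof (cases "fst x = fst y \<and> snd x \<noteq> snd y")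
    case True
    have "f (fst x) \<in> carrier H" "subst_value H f v \<in> carrier H"
      using assms f Cons subst_value_closed[of v] by auto
    then show ?thesis
      using True Cons
      by (cases "snd x") (auto simp: subst_value_Cons letter_value_def simp flip: m_assoc)
  qed (use Cons in auto)
qed simp

lemma subst_value_reduce:
  assumes "set w \<subseteq> S \<times> UNIV"
  shows "subst_value H f (reduce w) = subst_value H f w"
  using assms
proof (induction w)
  case (Cons x w)
  then have "set (reduce w) \<subseteq> S \<times> UNIV" "fst x \<in> S"
    using reduce_reduced_words[of w S] by (auto simp: reduced_words_def)
  with Cons show ?case
    using subst_value_push[of x "reduce w"] by (simp add: reduce_def subst_value_Cons)
qed (simp add: reduce_def)

end

lemma free_basis_universal_property:
  assumes G: "group G" "free_basis G S" and H: "group H" and f: "f ` S \<subseteq> carrier H"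
  shows "\<exists>h \<in> hom G H. \<forall>s\<in>S. h s = f s"
proof -
  interpret G: group G by (fact G(1))
  interpret H: group H by (fact H)
  have S: "(\<lambda>x. x) ` S \<subseteq> carrier G" and bij: "bij_betw (word_value G) (reduced_words S) (carrier G)"
    using G(2) by (auto simp: free_basis_def)
  have wv: "word_value G w = subst_value G (\<lambda>x. x) w" for w
    by (simp add: subst_value_def)
  define h where "h = (\<lambda>a. subst_value H f (the_inv_into (reduced_words S) (word_value G) a))"
  have h: "h (word_value G w) = subst_value H f w" if w: "set w \<subseteq> S \<times> UNIV" for w
  proof -
    have "word_value G w = word_value G (reduce w)"
      using subst_value_reduce[OF G(1) S w] by (simp add: wv)
    then show ?thesis
      using reduce_reduced_words[OF w] bij subst_value_reduce[OF H f w]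
      by (simp add: h_def bij_betw_def the_inv_into_f_f)
  qed
  have word: "\<exists>w. set w \<subseteq> S \<times> UNIV \<and> a = word_value G w" if "a \<in> carrier G" for a
    using bij that by (auto simp: bij_betw_def reduced_words_def)
  have "h \<in> hom G H"
  proof (rule homI)
    fix a assume "a \<in> carrier G"
    then show "h a \<in> carrier H"
      using word h subst_value_closed[OF H f] by metis
  next
    fix a b assume "a \<in> carrier G" "b \<in> carrier G"
    then obtain v w where vw: "set v \<subseteq> S \<times> UNIV" "a = word_value G v"
        "set w \<subseteq> S \<times> UNIV" "b = word_value G w"
      using word by meson
    then have "a \<otimes>\<^bsub>G\<^esub> b = word_value G (v @ w)"
      using subst_value_append[OF G(1) S] by (simp add: wv)
    then show "h (a \<otimes>\<^bsub>G\<^esub> b) = h a \<otimes>\<^bsub>H\<^esub> h b"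
      using vw h subst_value_append[OF H f] by simp
  qed
  moreover have "h s = f s" if "s \<in> S" for s
  proof -
    have "s \<in> carrier G" "f s \<in> carrier H" using S f that by auto
    then show ?thesis
      using h[of "[(s, True)]"] that
      by (simp add: word_value_def letter_value_def subst_value_def)
  qed
  ultimately show ?thesis by blast
qed

end

theory Submission
  imports Defs "HOL-Library.Sublist"
begin

text \<open>
  The lower bound comes from one well chosen counting quasimorphism. For a word \<open>p\<close>, let \<open>H\<close> be
  the function of Brooks that sends an element of the free group to the number of occurrences of
  \<open>p\<close> in its normal form minus the number of occurrences of \<open>p\<close> in that of its inverse. Choose \<open>p\<close> reduced
  and \<^emph>\<open>unbordered\<close>, i.e. no proper nonempty prefix is also a suffix, so that occurrences of \<open>p\<close>
  do not overlap.

  The defect of \<open>H\<close> is at most \<open>2\<close>: it is a signed count of the occurrences of \<open>p\<close> that cross the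
  centre of the tripod spanned by \<open>\<one>\<close>, \<open>g\<close> and \<open>g h\<close> in the Cayley tree. Each of the three paths
  through the centre contributes \<open>-1\<close>, \<open>0\<close> or \<open>1\<close>, and three contributions of the same sign are
  impossible for a reduced word (\<open>no_three_crossings\<close>). Homogenization at most doubles the defect
  (\<open>defect_homogenization\<close>, proved by an averaging argument in an arbitrary group), so the
  homogenization \<open>\<psi>\<close> of \<open>H\<close> has defect at most \<open>4\<close>.

  Modulo the relations \<open>g\<^sup>n = n g\<close> and conjugation, an integral chain is an integral combination
  of cyclically reduced words, no two of which are conjugate, even after inversion. These words can be
  taken unbordered, because the lexicographically least rotation of a word is either unbordered or
  a proper power (\<open>rotation_unbordered_or_power\<close>). If the combination is not zero, let \<open>p\<close> be a
  longest word with a nonzero coefficient. A factor of a power of a shorter word \<open>q\<close>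
  that is longer than \<open>q\<close> is periodic and therefore bordered, so \<open>p\<close> does not
  occur there, and neither does it in powers of words of the same length other than its rotations.
  Hence \<open>\<psi>\<close> takes the value \<open>1\<close> at \<open>p\<close> and vanishes at the other words, and its value on the chain
  is the coefficient of \<open>p\<close>, a nonzero integer (\<open>nonzero_chain_detected\<close>). Since the chain is
  a boundary, \<open>\<psi>\<close> is not a homomorphism, and it shows that \<open>scl\<close> is at least \<open>1 / (2 * 4)\<close>.
\<close>

section \<open>Homogenization of quasimorphisms\<close>

definition homogenization :: "('a, 'm) monoid_scheme \<Rightarrow> ('a \<Rightarrow> real) \<Rightarrow> 'a \<Rightarrow> real" where
  "homogenization G \<phi> g = lim (\<lambda>n. \<phi> (g [^]\<^bsub>G\<^esub> n) / real n)"

text \<open>Divide by \<open>n\<close> and let \<open>n\<close> tend to infinity. This is how estimates on powers lose their bounded errors.\<close>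

lemma le_if_archimedean_le:
  fixes x y B :: real
  assumes "\<And>n :: nat. n \<ge> 1 \<Longrightarrow> real n * x \<le> B + real n * y"
  shows "x \<le> y"
proof (rule ccontr)
  assume "\<not> x \<le> y"
  then obtain n :: nat where n: "B < real n * (x - y)"
    using reals_Archimedean3[of "x - y"] by auto
  have "n \<noteq> 0 \<Longrightarrow> False"
    using assms[of n] n by (simp add: algebra_simps)
  moreover have "n = 0 \<Longrightarrow> False"
    using assms[of 1] n \<open>\<not> x \<le> y\<close> by simp
  ultimately show False by blast
qed

lemma (in group) defect_bound_pow:
  assumes D: "D \<in> defect_bounds G \<phi>" and g: "g \<in> carrier G" and n: "n \<ge> 1"
  shows "\<bar>\<phi> (g [^] (n :: nat)) - real n * \<phi> g\<bar> \<le> real n * D"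
  using n
proof (induction n rule: dec_induct)
  case base
  then show ?case using D g by (auto simp: defect_bounds_def)
next
  case (step n)
  have "\<bar>\<phi> (g [^] n \<otimes> g) - \<phi> (g [^] n) - \<phi> g\<bar> \<le> D"
    using D g by (auto simp: defect_bounds_def)
  with step.IH show ?case
    by (simp add: algebra_simps abs_le_iff)
qed

text \<open>The distance to a function that is homogeneous on the powers of \<open>g\<close> is governed by the
  defect alone: however large the bound \<open>B\<close> on the distance, evaluating at \<open>g\<^sup>n\<close> and dividing
  by \<open>n\<close> removes it.\<close>

lemma (in group) bounded_distance_imp_distance_le_defect:
  assumes D: "D \<in> defect_bounds G \<phi>" and g: "g \<in> carrier G"
    and hom: "\<And>n :: nat. \<psi> (g [^] n) = real n * \<psi> g"
    and close: "\<And>n :: nat. \<bar>\<psi> (g [^] n) - \<phi> (g [^] n)\<bar> \<le> B"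
  shows "\<bar>\<psi> g - \<phi> g\<bar> \<le> D"
proof (rule le_if_archimedean_le[of _ B])
  fix n :: nat assume n: "n \<ge> 1"
  have "real n * \<bar>\<psi> g - \<phi> g\<bar> = \<bar>real n * \<psi> g - real n * \<phi> g\<bar>"
    by (simp add: abs_mult flip: right_diff_distrib)
  also have "\<dots> \<le> B + real n * D"
    using defect_bound_pow[OF D g n] close[of n] hom[of n] by (simp add: abs_le_iff)
  finally show "real n * \<bar>\<psi> g - \<phi> g\<bar> \<le> B + real n * D" .
qed

text \<open>Comparing both the \<open>n\<close>-th and the \<open>m\<close>-th term with the \<open>nm\<close>-th one shows that they differ by
  at most \<open>D / n + D / m\<close>, so the sequence is Cauchy.\<close>

lemma (in group) homogenization_tendsto:
  assumes D: "D \<in> defect_bounds G \<phi>" and g: "g \<in> carrier G"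
  shows "(\<lambda>n. \<phi> (g [^] n) / real n) \<longlonglongrightarrow> homogenization G \<phi> g"
proof -
  define a where "a = (\<lambda>n. \<phi> (g [^] n) / real n)"
  have mult: "\<bar>a (n * m) - a n\<bar> \<le> D / real n" if "n \<ge> 1" "m \<ge> 1" for n m :: nat
  proof -
    have "\<bar>\<phi> (g [^] (n * m)) - real m * \<phi> (g [^] n)\<bar> \<le> real m * D"
      using defect_bound_pow[OF D _ that(2), of "g [^] n"] g by (simp add: nat_pow_pow)
    then have "\<bar>\<phi> (g [^] (n * m)) - real m * \<phi> (g [^] n)\<bar> / (real n * real m)
        \<le> real m * D / (real n * real m)"
      by (intro divide_right_mono) auto
    moreover have "\<bar>\<phi> (g [^] (n * m)) - real m * \<phi> (g [^] n)\<bar> / (real n * real m)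
        = \<bar>(\<phi> (g [^] (n * m)) - real m * \<phi> (g [^] n)) / (real n * real m)\<bar>"
      by (simp add: abs_mult)
    moreover have "(\<phi> (g [^] (n * m)) - real m * \<phi> (g [^] n)) / (real n * real m) = a (n * m) - a n"
      using that by (simp add: a_def field_simps)
    ultimately show ?thesis
      using that by simp
  qed
  have diff: "\<bar>a m - a n\<bar> \<le> D / real n + D / real m" if "n \<ge> 1" "m \<ge> 1" for n m :: nat
    using mult[OF that] mult[OF that(2,1)] by (simp add: mult.commute abs_le_iff)
  have "Cauchy a"
  proof (rule CauchyI)
    fix e :: real assume e: "e > 0"
    obtain N :: nat where N: "2 * D / e < real N" using reals_Archimedean2 by blast
    have "norm (a m - a n) < e" if "m \<ge> Suc N" "n \<ge> Suc N" for m n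
    proof -
      have small: "D / real k < e / 2" if "k \<ge> Suc N" for k
      proof -
        have "2 * D / e < real k" using N that by simp
        then show ?thesis using e that by (simp add: field_simps)
      qed
      have "\<bar>a m - a n\<bar> \<le> D / real n + D / real m"
        using that by (intro diff) auto
      with small[OF that(1)] small[OF that(2)] show ?thesis
        unfolding real_norm_def by linarith
    qed
    then show "\<exists>M. \<forall>m\<ge>M. \<forall>n\<ge>M. norm (a m - a n) < e" by blast
  qed
  then have "convergent a" by (simp add: Cauchy_convergent_iff)
  then show ?thesis
    by (simp add: a_def homogenization_def convergent_LIMSEQ_iff)
qed

lemma (in group) homogenization_pow:
  assumes D: "D \<in> defect_bounds G \<phi>" and g: "g \<in> carrier G"
  shows "homogenization G \<phi> (g [^] (k :: nat)) = real k * homogenization G \<phi> g"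
proof (cases "k = 0")
  case True
  have "(\<lambda>n. \<phi> (\<one> [^] n) / real n) \<longlonglongrightarrow> 0"
    by (simp add: lim_const_over_n)
  then have "homogenization G \<phi> \<one> = 0"
    unfolding homogenization_def by (rule limI)
  with True show ?thesis by simp
next
  case False
  have "(\<lambda>n. \<phi> (g [^] (n * k)) / real (n * k)) \<longlonglongrightarrow> homogenization G \<phi> g"
    using LIMSEQ_subseq_LIMSEQ[OF homogenization_tendsto[OF D g], of "\<lambda>n. n * k"] False
    by (simp add: o_def strict_mono_def)
  then have "(\<lambda>n. real k * (\<phi> (g [^] (n * k)) / real (n * k))) \<longlonglongrightarrow> real k * homogenization G \<phi> g"
    by (rule tendsto_mult_left)
  moreover have "(\<lambda>n. real k * (\<phi> (g [^] (n * k)) / real (n * k)))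
      = (\<lambda>n. \<phi> ((g [^] k) [^] n) / real n)"
    using False g by (auto simp: nat_pow_pow mult.commute)
  ultimately show ?thesis
    unfolding homogenization_def[of G \<phi> "g [^] k"] by (simp add: limI)
qed

lemma (in group) homogenization_close:
  assumes D: "D \<in> defect_bounds G \<phi>" and g: "g \<in> carrier G"
  shows "\<bar>homogenization G \<phi> g - \<phi> g\<bar> \<le> D"
proof -
  have "\<bar>\<phi> (g [^] n) / real n - \<phi> g\<bar> \<le> D" if "n \<ge> 1" for n :: nat
  proof -
    have "\<bar>\<phi> (g [^] n) - real n * \<phi> g\<bar> / real n \<le> real n * D / real n"
      by (intro divide_right_mono defect_bound_pow[OF D g that]) simp
    moreover have "\<bar>\<phi> (g [^] n) - real n * \<phi> g\<bar> / real n = \<bar>(\<phi> (g [^] n) - real n * \<phi> g) / real n\<bar>"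
      by simp
    moreover have "(\<phi> (g [^] n) - real n * \<phi> g) / real n = \<phi> (g [^] n) / real n - \<phi> g"
      using that by (simp add: field_simps)
    ultimately show ?thesis using that by simp
  qed
  then have "eventually (\<lambda>n. \<bar>\<phi> (g [^] n) / real n - \<phi> g\<bar> \<le> D) sequentially"
    using eventually_sequentially by blast
  moreover have "(\<lambda>n. \<bar>\<phi> (g [^] n) / real n - \<phi> g\<bar>) \<longlonglongrightarrow> \<bar>homogenization G \<phi> g - \<phi> g\<bar>"
    by (intro tendsto_intros homogenization_tendsto[OF D g])
  ultimately show ?thesis
    by (intro tendsto_upperbound) auto
qed

lemma (in group) homogenization_inv:
  assumes D: "D \<in> defect_bounds G \<phi>" and g: "g \<in> carrier G"
  shows "homogenization G \<phi> (inv g) = - homogenization G \<phi> g"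
proof -
  let ?\<psi> = "homogenization G \<phi>"
  have "\<bar>\<phi> \<one>\<bar> \<le> D"
    using D by (force simp: defect_bounds_def)
  have "\<bar>?\<psi> (inv g) + ?\<psi> g\<bar> \<le> 0"
  proof (rule le_if_archimedean_le[of _ "4 * D"])
    fix n :: nat
    have "g [^] n \<otimes> (inv g) [^] n = \<one>"
      using g by (simp add: nat_pow_inv)
    then have "\<bar>\<phi> \<one> - \<phi> (g [^] n) - \<phi> ((inv g) [^] n)\<bar> \<le> D"
      using D g unfolding defect_bounds_def by (metis (mono_tags, lifting) mem_Collect_eq inv_closed nat_pow_closed)
    moreover have "\<bar>real n * ?\<psi> g - \<phi> (g [^] n)\<bar> \<le> D"
      using homogenization_close[OF D, of "g [^] n"] homogenization_pow[OF D g, of n] g by simp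
    moreover have "\<bar>real n * ?\<psi> (inv g) - \<phi> (inv g [^] n)\<bar> \<le> D"
      using homogenization_close[OF D, of "inv g [^] n"] homogenization_pow[OF D, of "inv g" n] g
      by simp
    ultimately have "\<bar>real n * ?\<psi> (inv g) + real n * ?\<psi> g\<bar> \<le> 4 * D"
      using \<open>\<bar>\<phi> \<one>\<bar> \<le> D\<close> by (simp add: abs_le_iff)
    then show "real n * \<bar>?\<psi> (inv g) + ?\<psi> g\<bar> \<le> 4 * D + real n * 0"
      by (simp add: abs_mult flip: distrib_left)
  qed
  then show ?thesis by simp
qed

text \<open>The triangle inequality through \<open>\<phi>\<close> would only give \<open>4 * D\<close>. To gain the factor \<open>2\<close>, replace
  \<open>\<phi>\<close> by a function adapted to \<open>h\<close>, namely the average \<open>\<chi>\<close> of \<open>\<phi> (h\<^sup>-\<^sup>k u h\<^sup>m)\<close> over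
  \<open>k, m < M\<close>. It has the same defect bound, because
  \<open>h\<^sup>-\<^sup>k u v h\<^sup>m = (h\<^sup>-\<^sup>k u h\<^sup>l) (h\<^sup>-\<^sup>l v h\<^sup>m)\<close> can be averaged over all three exponents, and it lies at
  bounded distance from \<open>\<phi>\<close>, hence within \<open>D\<close> of the homogenization \<open>\<psi>\<close>. The sum over \<open>m\<close>
  telescopes in \<open>\<chi> (u h) - \<chi> u\<close>, which makes this difference equal to \<open>\<psi> h\<close> up to
  \<open>2 * D / M\<close>. So only the two errors \<open>\<psi> - \<chi>\<close> at \<open>g h\<close> and at \<open>g\<close> remain.\<close>

lemma (in group) defect_homogenization:
  assumes D: "D \<in> defect_bounds G \<phi>"
  shows "2 * D \<in> defect_bounds G (homogenization G \<phi>)"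
proof -
  let ?\<psi> = "homogenization G \<phi>"
  have D0: "D \<ge> 0" using D by (simp add: defect_bounds_def)
  have qm: "\<bar>\<phi> (a \<otimes> b) - \<phi> a - \<phi> b\<bar> \<le> D" if "a \<in> carrier G" "b \<in> carrier G" for a b
    using D that by (auto simp: defect_bounds_def)
  have "\<bar>?\<psi> (g \<otimes> h) - ?\<psi> g - ?\<psi> h\<bar> \<le> 2 * D" if g: "g \<in> carrier G" and h: "h \<in> carrier G" for g h
  proof (rule le_if_archimedean_le[of _ "2 * D"])
    fix M :: nat assume M: "M \<ge> 1"
    define f where "f = (\<lambda>u k m. \<phi> (inv (h [^] (k::nat)) \<otimes> u \<otimes> h [^] (m::nat)))"
    define \<chi> where "\<chi> = (\<lambda>u. (\<Sum>k<M. \<Sum>m<M. f u k m) / (real M)\<^sup>2)"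
    have M0: "real M > 0" using M by simp
    have prod: "inv (h [^] k) \<otimes> u \<otimes> h [^] l \<otimes> (inv (h [^] l) \<otimes> v \<otimes> h [^] m)
        = inv (h [^] k) \<otimes> (u \<otimes> v) \<otimes> h [^] m"
      if "u \<in> carrier G" "v \<in> carrier G" for u v and k l m :: nat
    proof -
      have "h [^] l \<otimes> (inv (h [^] l) \<otimes> (v \<otimes> h [^] m)) = v \<otimes> h [^] m"
        using that h by (simp flip: m_assoc)
      then show ?thesis using that h by (simp add: m_assoc)
    qed
    have fqm: "\<bar>f (u \<otimes> v) k m - f u k l - f v l m\<bar> \<le> D"
      if "u \<in> carrier G" "v \<in> carrier G" for u v k l m
      using qm[of "inv (h [^] k) \<otimes> u \<otimes> h [^] l" "inv (h [^] l) \<otimes> v \<otimes> h [^] m"] that h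
      by (simp add: prod f_def)
    have \<chi>D: "D \<in> defect_bounds G \<chi>"
    proof -
      have "\<bar>\<chi> (u \<otimes> v) - \<chi> u - \<chi> v\<bar> \<le> D" if uv: "u \<in> carrier G" "v \<in> carrier G" for u v
      proof -
        have "(real M) ^ 3 * (\<chi> (u \<otimes> v) - \<chi> u - \<chi> v)
            = (\<Sum>k<M. \<Sum>l<M. \<Sum>m<M. f (u \<otimes> v) k m - f u k l - f v l m)"
        proof -
          have 1: "(\<Sum>k<M. \<Sum>l<M. \<Sum>m<M. f (u \<otimes> v) k m) = real M * (\<Sum>k<M. \<Sum>m<M. f (u \<otimes> v) k m)"
            by (simp add: sum_distrib_left)
          have 2: "(\<Sum>k<M. \<Sum>l<M. \<Sum>m<M. f u k l) = real M * (\<Sum>k<M. \<Sum>m<M. f u k m)"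
            by (simp add: sum_distrib_left)
          have 3: "(\<Sum>k<M. \<Sum>l<M. \<Sum>m<M. f v l m) = real M * (\<Sum>k<M. \<Sum>m<M. f v k m)"
            by simp
          show ?thesis
            unfolding sum_subtractf 1 2 3 \<chi>_def using M0
            by (simp add: field_simps power2_eq_square power3_eq_cube)
        qed
        also have "\<bar>\<dots>\<bar> \<le> (\<Sum>k<M. \<Sum>l<M. \<Sum>m<M. D)"
          by (intro order_trans[OF sum_abs] sum_mono fqm uv)
        also have "\<dots> = (real M) ^ 3 * D"
          by (simp add: power3_eq_cube)
        finally show ?thesis
          using M0 by (simp add: abs_mult)
      qed
      then show ?thesis using D0 by (auto simp: defect_bounds_def)
    qed
    \<comment> \<open>A bound that grows with \<open>M\<close> suffices: it disappears in the passage to powers.\<close>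
    define B where "B = (\<Sum>k<M. \<Sum>m<M. \<bar>\<phi> (inv (h [^] k))\<bar> + \<bar>\<phi> (h [^] m)\<bar> + 2 * D) / (real M)\<^sup>2"
    have \<chi>B: "\<bar>\<phi> u - \<chi> u\<bar> \<le> B" if u: "u \<in> carrier G" for u
    proof -
      have "\<chi> u - \<phi> u = (\<Sum>k<M. \<Sum>m<M. f u k m - \<phi> u) / (real M)\<^sup>2"
        using M0 by (simp add: \<chi>_def sum_subtractf field_simps power2_eq_square)
      also have "\<bar>\<dots>\<bar> \<le> B"
      proof -
        have "\<bar>f u k m - \<phi> u\<bar> \<le> \<bar>\<phi> (inv (h [^] k))\<bar> + \<bar>\<phi> (h [^] m)\<bar> + 2 * D" for k m
          using qm[of "inv (h [^] k) \<otimes> u" "h [^] m"] qm[of "inv (h [^] k)" u] u h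
          unfolding f_def by (auto simp: abs_le_iff)
        then show ?thesis
          unfolding B_def abs_divide
          by (simp only: abs_power2)
             (intro divide_right_mono order_trans[OF sum_abs] sum_mono; simp)
      qed
      finally show ?thesis by (simp add: abs_minus_commute)
    qed
    have \<psi>\<chi>: "\<bar>?\<psi> u - \<chi> u\<bar> \<le> D" if u: "u \<in> carrier G" for u
    proof (rule bounded_distance_imp_distance_le_defect[OF \<chi>D u])
      show "?\<psi> (u [^] n) = real n * ?\<psi> u" for n :: nat
        by (rule homogenization_pow[OF D u])
      show "\<bar>?\<psi> (u [^] n) - \<chi> (u [^] n)\<bar> \<le> D + B" for n :: nat
        using homogenization_close[OF D, of "u [^] n"] \<chi>B[of "u [^] n"] u by (simp add: abs_le_iff)
    qed
    have shift: "\<bar>real M * (\<chi> (g \<otimes> h) - \<chi> g - ?\<psi> h)\<bar> \<le> 2 * D"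
    proof -
      have step: "f (g \<otimes> h) k m = f g k (Suc m)" for k m
        unfolding f_def nat_pow_Suc2[OF h] using g h by (simp add: m_assoc)
      have hM: "\<bar>real M * ?\<psi> h - \<phi> (h [^] M)\<bar> \<le> D"
        using homogenization_close[OF D, of "h [^] M"] homogenization_pow[OF D h, of M] h by simp
      have "(real M)\<^sup>2 * (\<chi> (g \<otimes> h) - \<chi> g - ?\<psi> h)
          = (\<Sum>k<M. \<Sum>m<M. f (g \<otimes> h) k m - f g k m) - (real M)\<^sup>2 * ?\<psi> h"
        using M0 by (simp add: \<chi>_def sum_subtractf field_simps)
      also have "\<dots> = (\<Sum>k<M. f g k M - f g k 0) - (real M)\<^sup>2 * ?\<psi> h"
        by (simp only: step sum_lessThan_telescope)
      also have "\<dots> = (\<Sum>k<M. f g k M - f g k 0 - real M * ?\<psi> h)"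
        by (simp add: sum_subtractf power2_eq_square)
      also have "\<bar>\<dots>\<bar> \<le> (\<Sum>k<M. 2 * D)"
      proof (intro order_trans[OF sum_abs] sum_mono)
        fix k
        show "\<bar>f g k M - f g k 0 - real M * ?\<psi> h\<bar> \<le> 2 * D"
          using qm[of "inv (h [^] k) \<otimes> g" "h [^] M"] hM g h
          unfolding f_def by (auto simp: abs_le_iff)
      qed
      finally have "\<bar>real M * (real M * (\<chi> (g \<otimes> h) - \<chi> g - ?\<psi> h))\<bar> \<le> real M * (2 * D)"
        by (simp add: power2_eq_square mult.assoc)
      then show ?thesis
        using M0 by (simp add: abs_mult)
    qed
    have "\<bar>?\<psi> (g \<otimes> h) - ?\<psi> g - ?\<psi> h\<bar> \<le> 2 * D + \<bar>\<chi> (g \<otimes> h) - \<chi> g - ?\<psi> h\<bar>"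
      using \<psi>\<chi>[of "g \<otimes> h"] \<psi>\<chi>[of g] g h by auto
    then have "real M * \<bar>?\<psi> (g \<otimes> h) - ?\<psi> g - ?\<psi> h\<bar>
        \<le> real M * (2 * D + \<bar>\<chi> (g \<otimes> h) - \<chi> g - ?\<psi> h\<bar>)"
      using M0 by (intro mult_left_mono) auto
    then show "real M * \<bar>?\<psi> (g \<otimes> h) - ?\<psi> g - ?\<psi> h\<bar> \<le> 2 * D + real M * (2 * D)"
      using shift by (simp add: abs_mult distrib_left)
  qed
  then show ?thesis using D0 by (simp add: defect_bounds_def)
qed

lemma (in group) homogeneous_quasimorphism_homogenization:
  assumes D: "D \<in> defect_bounds G \<phi>"
  shows "homogeneous_quasimorphism G (homogenization G \<phi>)"
proof -
  have "homogenization G \<phi> (g [^] n) = of_int n * homogenization G \<phi> g" if "g \<in> carrier G" for g n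
  proof (cases n rule: int_cases2)
    case (nonneg m)
    then show ?thesis using homogenization_pow[OF D that] by (simp add: int_pow_int)
  next
    case (nonpos m)
    then show ?thesis
      using homogenization_pow[OF D that] homogenization_inv[OF D, of "g [^] m"] that
      by (simp add: int_pow_neg int_pow_int)
  qed
  then show ?thesis
    using defect_homogenization[OF D]
    by (auto simp: homogeneous_quasimorphism_def quasimorphism_def)
qed

section \<open>Counting occurrences of a word\<close>

definition inv_letter :: "'a letter \<Rightarrow> 'a letter" where
  "inv_letter x = (fst x, \<not> snd x)"

definition inv_word :: "'a letter list \<Rightarrow> 'a letter list" where
  "inv_word w = rev (map inv_letter w)"

lemma inv_letter_simps [simp]:
  "inv_letter (inv_letter x) = x" "inv_letter x \<noteq> x" "x \<noteq> inv_letter x" "fst (inv_letter x) = fst x"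
  by (auto simp: inv_letter_def prod_eq_iff)

lemma inv_word_simps [simp]:
  "inv_word [] = []"
  "inv_word (u @ v) = inv_word v @ inv_word u"
  "inv_word (inv_word w) = w"
  "length (inv_word w) = length w"
  "inv_word w = [] \<longleftrightarrow> w = []"
  by (auto simp: inv_word_def rev_map comp_def)

lemma inv_word_Cons [simp]: "inv_word (x # w) = inv_word w @ [inv_letter x]"
  by (simp add: inv_word_def)

lemma inv_word_nth: "i < length w \<Longrightarrow> inv_word w ! i = inv_letter (w ! (length w - Suc i))"
  by (simp add: inv_word_def rev_nth)

lemma reduced_word_iff: "reduced_word w \<longleftrightarrow> successively (\<lambda>x y. y \<noteq> inv_letter x) w"
  unfolding reduced_word_def
  by (rule arg_cong[of _ _ "\<lambda>P. successively P w"]) (auto simp: fun_eq_iff inv_letter_def prod_eq_iff)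

lemma reduced_word_simps [simp]: "reduced_word []" "reduced_word [x]"
  by (simp_all add: reduced_word_def)

lemma reduced_word_nth:
  "reduced_word w \<Longrightarrow> Suc i < length w \<Longrightarrow> w ! Suc i \<noteq> inv_letter (w ! i)"
  by (auto simp: reduced_word_iff successively_conv_nth)

lemma reduced_word_append:
  "reduced_word (u @ v) \<longleftrightarrow>
     reduced_word u \<and> reduced_word v \<and> (u = [] \<or> v = [] \<or> hd v \<noteq> inv_letter (last u))"
  by (auto simp: reduced_word_iff successively_append_iff)

lemma reduced_word_inv_word: "reduced_word w \<Longrightarrow> reduced_word (inv_word w)"
  unfolding reduced_word_iff inv_word_def successively_rev successively_map
  by (erule successively_mono) auto

text \<open>Two distinct occurrences of an unbordered word in another word never overlap.\<close>

definition unbordered :: "'x list \<Rightarrow> bool" where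
  "unbordered p \<longleftrightarrow> (\<forall>u. u \<noteq> [] \<and> prefix u p \<and> suffix u p \<longrightarrow> u = p)"

text \<open>A border of length \<open>length p - d\<close> is the same thing as a period \<open>d\<close>.\<close>

lemma unbordered_not_periodic:
  assumes "unbordered p" "0 < d" "d < length p"
  shows "\<exists>i < length p - d. p ! (i + d) \<noteq> p ! i"
proof (rule ccontr)
  assume *: "\<not> ?thesis"
  have "take (length p - d) p = drop d p"
    by (rule nth_equalityI) (use * in \<open>auto simp: add.commute\<close>)
  then have "prefix (drop d p) p"
    by (metis take_is_prefix)
  moreover have "suffix (drop d p) p" by (rule suffix_drop)
  ultimately have "drop d p = p"
    using assms by (auto simp: unbordered_def)
  then have "length (drop d p) = length p" by simp
  then show False using assms by simp
qed

fun occurrences :: "'x list \<Rightarrow> 'x list \<Rightarrow> nat" where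
  "occurrences p [] = 0"
| "occurrences p (x # w) = (if prefix p (x # w) then 1 else 0) + occurrences p w"

text \<open>The number of occurrences of \<open>p\<close> in \<open>a @ b\<close> that contain letters of both \<open>a\<close> and \<open>b\<close>; \<open>j\<close> is
  the number of letters in \<open>a\<close>.\<close>

definition crossings :: "'x list \<Rightarrow> 'x list \<Rightarrow> 'x list \<Rightarrow> nat" where
  "crossings p a b =
     card {j. 0 < j \<and> j < length p \<and> suffix (take j p) a \<and> prefix (drop j p) b}"

lemma occurrences_pos_factor: "occurrences p w > 0 \<Longrightarrow> \<exists>a b. w = a @ p @ b"
proof (induction w)
  case (Cons x w)
  show ?case
  proof (cases "prefix p (x # w)")
    case True
    then obtain b where "x # w = [] @ p @ b" by (auto simp: prefix_def)
    then show ?thesis by blast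
  next
    case False
    with Cons obtain a b where "w = a @ p @ b" by auto
    then have "x # w = (x # a) @ p @ b" by simp
    then show ?thesis by blast
  qed
qed simp

lemma occurrences_append:
  assumes "p \<noteq> []"
  shows "occurrences p (a @ b) = occurrences p a + occurrences p b + crossings p a b"
proof (induction a)
  case Nil
  have "{j. 0 < j \<and> j < length p \<and> suffix (take j p) [] \<and> prefix (drop j p) b} = {}"
    using assms by auto
  then show ?case unfolding crossings_def by (metis add.right_neutral add_0 append_Nil card.empty occurrences.simps(1))
next
  case (Cons x a)
  let ?l = "length (x # a)"
  let ?J = "\<lambda>a. {j. 0 < j \<and> j < length p \<and> suffix (take j p) a \<and> prefix (drop j p) b}"
  define E where "E = {j. j = ?l \<and> j < length p \<and> take j p = x # a \<and> prefix (drop j p) b}"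
  have suf: "suffix (take j p) (x # a) \<longleftrightarrow> take j p = x # a \<or> suffix (take j p) a" for j
    by (auto simp: suffix_Cons)
  have J: "?J (x # a) = ?J a \<union> E"
    unfolding E_def suf by (auto dest: arg_cong[of _ _ length])
  have "?J a \<inter> E = {}"
    unfolding E_def by (auto dest!: suffix_length_le)
  moreover have "finite (?J a)" "finite E"
    by (auto simp: E_def)
  ultimately have 1: "crossings p (x # a) b = crossings p a b + card E"
    unfolding crossings_def J by (rule card_Un_disjoint[rotated 2])
  have 2: "prefix p (x # a @ b) \<longleftrightarrow> prefix p (x # a) \<or> E \<noteq> {}"
  proof
    assume pre: "prefix p (x # a @ b)"
    show "prefix p (x # a) \<or> E \<noteq> {}"
    proof (cases "length p \<le> ?l")
      case True
      then show ?thesis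
        using pre prefix_length_prefix[of p "x # a @ b" "x # a"] by auto
    next
      case False
      have "prefix (x # a) (x # a @ b)" by simp
      with pre False have "prefix (x # a) p"
        using prefix_length_prefix[of "x # a" "x # a @ b" p] by auto
      then obtain c where c: "p = (x # a) @ c" by (auto simp: prefix_def)
      then have "?l \<in> E"
        using pre False by (auto simp: E_def)
      then show ?thesis by blast
    qed
  next
    assume "prefix p (x # a) \<or> E \<noteq> {}"
    then show "prefix p (x # a @ b)"
    proof
      assume "prefix p (x # a)"
      then show ?thesis by (metis append_Cons prefix_prefix)
    next
      assume "E \<noteq> {}"
      then have "take ?l p = x # a" "prefix (drop ?l p) b" by (auto simp: E_def)
      then have "prefix (take ?l p @ drop ?l p) ((x # a) @ b)" by (metis same_prefix_prefix)
      then show ?thesis by simp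
    qed
  qed
  have 3: "\<not> (prefix p (x # a) \<and> E \<noteq> {})"
    by (auto simp: E_def dest!: prefix_length_le)
  have 4: "card E = (if E \<noteq> {} then 1 else 0)"
  proof -
    have "E \<subseteq> {?l}" by (auto simp: E_def)
    then show ?thesis by (auto simp: subset_singleton_iff)
  qed
  show ?case
    using Cons.IH 1 2 3 4 by (auto split: if_splits)
qed

text \<open>All occurrences that cross the junction overlap each other.\<close>

lemma crossings_le_1:
  assumes "unbordered p"
  shows "crossings p a b \<le> 1"
proof -
  have no: False if "0 < j" "j < k" "k < length p" "suffix (take j p) a" "suffix (take k p) a"
      "prefix (drop j p) b" "prefix (drop k p) b" for j k
  proof -
    define d where "d = k - j"
    have suf: "suffix (take j p) (take k p)"
      using that suffix_length_suffix[of "take j p" a "take k p"] by simp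
    have pre: "prefix (drop k p) (drop j p)"
      using that prefix_length_prefix[of "drop k p" b "drop j p"] by simp
    have "p ! (i + d) = p ! i" if i: "i < length p - d" for i
    proof (cases "i < j")
      case True
      obtain z where z: "take k p = z @ take j p" using suf by (auto simp: suffix_def)
      then have "length (take k p) = length (z @ take j p)" by (rule arg_cong)
      then have "length z = d" using \<open>j < k\<close> \<open>k < length p\<close> by (simp add: d_def)
      then have "take k p ! (d + i) = take j p ! i" using z by (simp add: nth_append)
      then show ?thesis using True \<open>j < k\<close> by (simp add: d_def add.commute)
    next
      case False
      obtain z where z: "drop j p = drop k p @ z" using pre by (auto simp: prefix_def)
      have "i - j < length (drop k p)" using i False \<open>j < k\<close> \<open>k < length p\<close> by (simp add: d_def)
      then have "drop j p ! (i - j) = drop k p ! (i - j)" by (simp add: z nth_append)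
      then show ?thesis using False i \<open>j < k\<close> \<open>k < length p\<close> by (simp add: d_def add.commute)
    qed
    moreover have "0 < d" "d < length p" using that by (auto simp: d_def)
    ultimately show False
      using unbordered_not_periodic[OF assms] by blast
  qed
  define J where "J = {j. 0 < j \<and> j < length p \<and> suffix (take j p) a \<and> prefix (drop j p) b}"
  have "j = k" if "j \<in> J" "k \<in> J" for j k
    using no[of j k] no[of k j] that unfolding J_def
    by (cases j k rule: linorder_cases) blast+
  moreover have "finite J" by (simp add: J_def)
  ultimately have "card J \<le> 1" by (simp add: card_le_Suc0_iff_eq)
  then show ?thesis by (simp add: crossings_def J_def)
qed

lemma crossings_posE:
  assumes "crossings p a b > 0"
  obtains j where "0 < j" "j < length p" "suffix (take j p) a" "prefix (drop j p) b"
proof -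
  have "{j. 0 < j \<and> j < length p \<and> suffix (take j p) a \<and> prefix (drop j p) b} \<noteq> {}"
    using assms unfolding crossings_def by (metis card.empty less_irrefl)
  then show ?thesis using that by blast
qed

lemma suffix_inv_word: "suffix u (inv_word w) \<Longrightarrow> prefix (inv_word u) w"
  by (metis inv_word_simps(2,3) prefixI suffixE)

text \<open>Both the letters of \<open>p\<close> read forwards from the cut at \<open>j\<close> and the inverted letters read backwards
  from the cut at \<open>k\<close> spell an initial part of \<open>q\<close>. If \<open>j \<le> k\<close>, the two readings meet inside \<open>p\<close>: either at a letter
  that would be its own inverse, or at two adjacent letters that would be inverse to each other.
  Both are impossible in a reduced word.\<close>

lemma opposite_readings_order:
  assumes p: "reduced_word p" and j: "0 < j" "j < length p" and k: "0 < k" "k < length p"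
    and pre: "prefix (drop j p) q" "prefix (inv_word (take k p)) q"
  shows "k < j"
proof (rule ccontr)
  assume "\<not> k < j"
  define i where "i = (k - j) div 2"
  have i: "i < length p - j" "i < k"
    using \<open>\<not> k < j\<close> j k by (auto simp: i_def)
  have "drop j p ! i = q ! i"
    using pre(1) i by (auto simp: prefix_def nth_append)
  moreover have "inv_word (take k p) ! i = q ! i"
    using pre(2) i k by (auto simp: prefix_def nth_append)
  ultimately have eq: "p ! (j + i) = inv_letter (p ! (k - Suc i))"
    using i j k by (simp add: inv_word_nth)
  show False
  proof (cases "even (k - j)")
    case True
    then have "k = j + 2 * i"
      using \<open>\<not> k < j\<close> by (simp add: i_def)
    then have "Suc (k - Suc i) = j + i" using j by linarith
    then show False
      using eq reduced_word_nth[OF p, of "k - Suc i"] i j by (auto simp: less_diff_conv)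
  next
    case False
    then have "k = Suc (j + 2 * i)"
      using \<open>\<not> k < j\<close> odd_two_times_div_two_succ[OF False] by (simp add: i_def)
    then have "k - Suc i = j + i" by simp
    then show False
      using eq by (metis inv_letter_simps(2))
  qed
qed

text \<open>Consider three legs \<open>u\<close>, \<open>v\<close>, \<open>w\<close> of a tripod, oriented away from its centre, and suppose that
  \<open>p\<close> occurs along each of the paths from \<open>u\<close> to \<open>v\<close>, from \<open>v\<close> to \<open>w\<close> and from \<open>w\<close> to \<open>u\<close> across
  the centre. On each leg one occurrence leaves the centre and another one arrives, so the cut
  points of the three occurrences would form a cycle of strict inequalities.\<close>

lemma no_three_crossings:
  assumes p: "reduced_word p"
    and pos: "crossings p (inv_word u) v > 0" "crossings p (inv_word v) w > 0"
      "crossings p (inv_word w) u > 0"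
  shows False
proof -
  obtain i where i: "0 < i" "i < length p" "suffix (take i p) (inv_word u)" "prefix (drop i p) v"
    using pos(1) by (rule crossings_posE)
  obtain j where j: "0 < j" "j < length p" "suffix (take j p) (inv_word v)" "prefix (drop j p) w"
    using pos(2) by (rule crossings_posE)
  obtain k where k: "0 < k" "k < length p" "suffix (take k p) (inv_word w)" "prefix (drop k p) u"
    using pos(3) by (rule crossings_posE)
  have "j < i" "k < j" "i < k"
    using opposite_readings_order[OF p] i j k by (meson suffix_inv_word)+
  then show False by simp
qed

definition brooks :: "'a letter list \<Rightarrow> 'a letter list \<Rightarrow> int" where
  "brooks p w = int (occurrences p w) - int (occurrences p (inv_word w))"

lemma brooks_inv_word: "brooks p (inv_word w) = - brooks p w"
  by (simp add: brooks_def)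

lemma brooks_append:
  assumes "p \<noteq> []"
  shows "brooks p (a @ b) = brooks p a + brooks p b
    + (int (crossings p a b) - int (crossings p (inv_word b) (inv_word a)))"
  using assms by (simp add: brooks_def occurrences_append)

text \<open>In a free group the words \<open>a @ x\<close>, \<open>inv_word x @ b\<close> and \<open>a @ b\<close> are the normal forms of two
  elements and of their product, so this bounds the defect of the counting function by \<open>2\<close>. The
  contributions of the three legs cancel, and what remains is a signed number of crossings at
  the centre of a tripod: at most one of each sign on each of the three paths, and not three of
  the same sign.\<close>

lemma brooks_tripod:
  assumes p: "reduced_word p" "unbordered p" "p \<noteq> []"
  shows "\<bar>brooks p (a @ b) - brooks p (a @ x) - brooks p (inv_word x @ b)\<bar> \<le> 2"
proof -
  let ?c = "\<lambda>u v. crossings p (inv_word u) v"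
  let ?u = "inv_word a"
  have eq: "brooks p (a @ b) - brooks p (a @ x) - brooks p (inv_word x @ b) =
      (int (?c ?u b) + int (?c b x) + int (?c x ?u)) - (int (?c ?u x) + int (?c x b) + int (?c b ?u))"
    by (simp add: brooks_append[OF p(3)] brooks_inv_word)
  have le: "?c u v \<le> 1" for u v by (rule crossings_le_1[OF p(2)])
  have "?c u v + ?c v w + ?c w u \<le> 2" for u v w
    using no_three_crossings[OF p(1), of u v w] le[of u v] le[of v w] le[of w u] by force
  from this[of ?u b x] this[of ?u x b] show ?thesis
    unfolding eq by linarith
qed

section \<open>Occurrences in powers of a word\<close>

lemma nth_concat_replicate:
  "i < n * length c \<Longrightarrow> concat (replicate n c) ! i = c ! (i mod length c)"
proof (induction n arbitrary: i)
  case (Suc n)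
  then show ?case
    by (cases "i < length c") (auto simp: nth_append le_mod_geq)
qed simp

lemma inv_word_concat_replicate: "inv_word (concat (replicate n c)) = concat (replicate n (inv_word c))"
proof (induction n)
  case (Suc n)
  have "concat (replicate n d) @ d = d @ concat (replicate n d)" for d :: "'a letter list"
    by (induction n) auto
  with Suc show ?case by simp
qed simp

lemma factor_of_power_nth:
  assumes "concat (replicate n c) = a @ q @ b" "i < length q"
  shows "q ! i = c ! ((length a + i) mod length c)"
proof -
  have "n * length c = length (a @ q @ b)"
    by (simp flip: assms(1) add: length_concat sum_list_replicate)
  then have "concat (replicate n c) ! (length a + i) = c ! ((length a + i) mod length c)"
    using assms(2) by (intro nth_concat_replicate) simp
  then show ?thesis
    using assms by (simp add: nth_append)
qed

text \<open>The power has period \<open>length c\<close>, and so has every factor of it; a period shorter than the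
  factor gives a border of it.\<close>

lemma unbordered_factor_of_power:
  assumes eq: "concat (replicate n c) = a @ q @ b" and q: "unbordered q" and c: "c \<noteq> []"
  shows "length q \<le> length c"
proof (rule ccontr)
  assume "\<not> ?thesis"
  then have len: "length c < length q" by simp
  have "q ! (i + length c) = q ! i" if "i < length q - length c" for i
    using factor_of_power_nth[OF eq, of i] factor_of_power_nth[OF eq, of "i + length c"] that
    by (simp flip: add.assoc)
  then show False
    using unbordered_not_periodic[OF q, of "length c"] c len by auto
qed

lemma factor_of_power_rotate:
  assumes eq: "concat (replicate n c) = a @ q @ b" and len: "length q = length c"
  shows "q = rotate (length a) c"
  by (rule nth_equalityI)
     (use len in \<open>auto simp: factor_of_power_nth[OF eq] nth_rotate add.commute\<close>)

text \<open>Inverting a word exchanges its two halves, so a word equal to its inverse has a cancellation, or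
  a letter that is its own inverse, in the middle.\<close>

lemma self_inverse_reduced_word:
  assumes "reduced_word u" "inv_word u = u"
  shows "u = []"
proof (rule ccontr)
  assume "u \<noteq> []"
  define i where "i = length u div 2"
  have i: "i < length u" using \<open>u \<noteq> []\<close> by (auto simp: i_def)
  then have eq: "u ! i = inv_letter (u ! (length u - Suc i))"
    using inv_word_nth[of i u] assms(2) by simp
  show False
  proof (cases "even (length u)")
    case True
    then have "length u = 2 * i" by (simp add: i_def)
    then have "Suc (length u - Suc i) = i" using i by linarith
    then show False
      using eq i reduced_word_nth[OF assms(1), of "length u - Suc i"] by auto
  next
    case False
    then have "length u - Suc i = i" by (auto simp: i_def elim!: oddE)
    then show False using eq by (metis inv_letter_simps(2))
  qed
qed

lemma not_rotation_of_inverse: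
  assumes "reduced_word p" "p \<noteq> []"
  shows "p \<noteq> rotate i (inv_word p)"
proof
  assume eq: "p = rotate i (inv_word p)"
  define m where "m = i mod length p"
  define u v where "u = take m (inv_word p)" and "v = drop m (inv_word p)"
  have uv: "inv_word p = u @ v" by (simp add: u_def v_def)
  have p: "p = v @ u"
    using eq by (simp add: rotate_drop_take u_def v_def m_def)
  then have "inv_word u @ inv_word v = u @ v" using uv by simp
  then have "inv_word u = u" "inv_word v = v" by auto
  moreover have "reduced_word u" "reduced_word v"
    using assms(1) by (auto simp: p reduced_word_append)
  ultimately show False
    using self_inverse_reduced_word p assms(2) by blast
qed

text \<open>An unbordered word can only be found in powers of words that are at least as long, and among the
  words of equal length only in powers of its rotations. This separates \<open>p\<close> from all other
  words up to its length.\<close>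

lemma brooks_power_eq_0:
  assumes p: "unbordered p" and q: "q \<noteq> []" "length q \<le> length p"
    and not_rot: "\<And>i. p \<noteq> rotate i q" "\<And>i. p \<noteq> rotate i (inv_word q)"
  shows "brooks p (concat (replicate n q)) = 0"
proof -
  have "occurrences p (concat (replicate n c)) = 0"
    if c: "c \<noteq> []" "length c \<le> length p" "\<And>i. p \<noteq> rotate i c" for c
  proof (rule ccontr)
    assume "occurrences p (concat (replicate n c)) \<noteq> 0"
    then obtain a b where eq: "concat (replicate n c) = a @ p @ b"
      using occurrences_pos_factor by blast
    then have "length p = length c"
      using unbordered_factor_of_power[OF eq p c(1)] c(2) by simp
    then show False
      using factor_of_power_rotate[OF eq] c(3) by blast
  qed
  from this[of q] this[of "inv_word q"] show ?thesis
    using q not_rot by (simp add: brooks_def inv_word_concat_replicate)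
qed

lemma occurrences_self: "p \<noteq> [] \<Longrightarrow> occurrences p p = 1"
proof -
  assume "p \<noteq> []"
  then obtain x w where p: "p = x # w" by (cases p) auto
  have "occurrences p w = 0" if "length w < length p" for w
    using that by (induction w) (auto dest: prefix_length_le)
  then show ?thesis by (subst (2) p) (simp add: p)
qed

text \<open>Occurrences of \<open>p\<close> in its powers never cross a junction, as this would give a border of \<open>p\<close>.\<close>

lemma brooks_power_self:
  assumes p: "reduced_word p" "unbordered p" "p \<noteq> []"
  shows "brooks p (concat (replicate n p)) = int n"
proof -
  have cross: "crossings p p w = 0" for w
  proof (rule ccontr)
    assume "crossings p p w \<noteq> 0"
    then obtain j where "0 < j" "j < length p" "suffix (take j p) p"
      by (auto elim: crossings_posE)
    moreover have "prefix (take j p) p" by (rule take_is_prefix)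
    moreover have "take j p \<noteq> []" using \<open>0 < j\<close> p(3) by simp
    ultimately have "take j p = p" using p(2) unfolding unbordered_def by blast
    then have "length (take j p) = length p" by (rule arg_cong)
    then show False using \<open>j < length p\<close> by simp
  qed
  have "occurrences p (concat (replicate n p)) = n"
    by (induction n) (simp_all add: occurrences_append[OF p(3)] cross occurrences_self[OF p(3)])
  moreover have "occurrences p (concat (replicate n (inv_word p))) = 0"
  proof (rule ccontr)
    assume "occurrences p (concat (replicate n (inv_word p))) \<noteq> 0"
    then obtain a b where "concat (replicate n (inv_word p)) = a @ p @ b"
      using occurrences_pos_factor by blast
    from factor_of_power_rotate[OF this] show False
      using not_rotation_of_inverse[OF p(1,3)] by auto
  qed
  ultimately show ?thesis by (simp add: brooks_def inv_word_concat_replicate)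
qed

section \<open>Unbordered rotations\<close>

text \<open>The number with the digits \<open>map e w\<close> in base \<open>B\<close>. For words of equal length, comparing these
  numbers is the lexicographic comparison, in a form that is decided by arithmetic.\<close>

definition numeral_value :: "nat \<Rightarrow> ('x \<Rightarrow> nat) \<Rightarrow> 'x list \<Rightarrow> nat" where
  "numeral_value B e w = foldl (\<lambda>n x. n * B + e x) 0 w"

lemma numeral_value_append:
  "numeral_value B e (u @ v) = numeral_value B e u * B ^ length v + numeral_value B e v"
proof (induction v rule: rev_induct)
  case (snoc x v)
  then show ?case by (simp add: numeral_value_def algebra_simps)
qed (simp add: numeral_value_def)

lemma numeral_value_inject:
  assumes "inj_on e A" "e ` A \<subseteq> {..<B}" "set u \<subseteq> A" "set v \<subseteq> A" "length u = length v"
    "numeral_value B e u = numeral_value B e v"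
  shows "u = v"
  using assms(5,3,4,6)
proof (induction u v rule: rev_induct2)
  case (4 x u y v)
  have B: "e x < B" "e y < B" using assms(2) 4 by auto
  have eq: "numeral_value B e u * B + e x = numeral_value B e v * B + e y"
    using 4 by (simp add: numeral_value_append) (simp add: numeral_value_def)
  then have "(numeral_value B e u * B + e x) mod B = (numeral_value B e v * B + e y) mod B" by simp
  then have "e x = e y" using B by simp
  then have "x = y" "numeral_value B e u = numeral_value B e v"
    using assms(1) 4 eq B by (auto dest: inj_onD)
  then show ?case using 4 by simp
qed auto

text \<open>The idea of Lyndon words: take a lexicographically least rotation \<open>v\<close>. If \<open>u\<close> is a border of
  \<open>v = u @ s = t @ u\<close>, then \<open>s @ u\<close> and \<open>u @ t\<close> are rotations of \<open>v\<close> as well; minimality gives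
  \<open>t \<le> s\<close> from the first and \<open>s \<le> t\<close> from the second. So \<open>s = t\<close>, whence \<open>u\<close> and \<open>s\<close> commute and
  are powers of a common word.\<close>

lemma rotation_unbordered_or_power:
  fixes w :: "'x list"
  assumes "w \<noteq> []"
  shows "(\<exists>i. unbordered (rotate i w)) \<or>
    (\<exists>i k c. k \<ge> 2 \<and> c \<noteq> [] \<and> rotate i w = concat (replicate k c))"
proof -
  obtain e :: "'x \<Rightarrow> nat" where e: "inj_on e (set w)"
    using finite_imp_inj_to_nat_seg[of "set w"] by auto
  define B where "B = Suc (Max (e ` set w))"
  have eB: "e ` set w \<subseteq> {..<B}" by (auto simp: B_def le_imp_less_Suc)
  let ?N = "numeral_value B e"
  obtain i where i: "\<And>j. ?N (rotate i w) \<le> ?N (rotate j w)"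
    using arg_min_nat_le[of "\<lambda>_. True"] ex_has_least_nat[of "\<lambda>_. True" 0 "\<lambda>i. ?N (rotate i w)"]
    by blast
  define v where "v = rotate i w"
  have min: "?N v \<le> ?N (rotate j v)" for j
    unfolding v_def rotate_rotate by (rule i)
  show ?thesis
  proof (cases "unbordered v")
    case False
    then obtain u where u: "u \<noteq> []" "prefix u v" "suffix u v" "u \<noteq> v"
      by (auto simp: unbordered_def)
    then obtain s where s: "v = u @ s" by (auto simp: prefix_def)
    from u obtain t where t: "v = t @ u" by (auto simp: suffix_def)
    have len: "length s = length t"
      using s t by (metis add.commute add_left_imp_eq length_append)
    have "?N (u @ s) \<le> ?N (u @ t)" "?N (t @ u) \<le> ?N (s @ u)"
      using min[of "length t"] min[of "length u"] s t by (metis rotate_append)+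
    then have "?N s = ?N t"
      using len by (simp add: numeral_value_append)
        (metis (full_types) B_def le_antisym mult_le_cancel2 nat_zero_less_power_iff zero_less_Suc)
    moreover have "set s \<subseteq> set w" "set t \<subseteq> set w"
      using s t unfolding v_def by (metis set_append set_rotate sup_ge1 sup_ge2)+
    ultimately have "s = t"
      using numeral_value_inject[OF e eB _ _ len] by simp
    then have "u @ s = s @ u" using s t by simp
    then obtain m n z where z: "concat (replicate m z) = u" "concat (replicate n z) = s"
      using comm_append_are_replicate by blast
    have "s \<noteq> []" using s u by auto
    with z u(1) have "m \<noteq> 0" "n \<noteq> 0" "z \<noteq> []" by (auto simp: concat_replicate_trivial)
    moreover have "v = concat (replicate (m + n) z)"
      by (simp add: s z replicate_add)
    ultimately have "\<exists>i k c. k \<ge> 2 \<and> c \<noteq> [] \<and> rotate i w = concat (replicate k c)"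
      by (intro exI[of _ i] exI[of _ "m + n"] exI[of _ z]) (auto simp: v_def)
    then show ?thesis ..
  qed (auto simp: v_def)
qed

section \<open>Reduced words in products and powers\<close>

lemma reduced_words_cancel:
  assumes "reduced_word u" "reduced_word v"
  shows "\<exists>a x b. u = a @ x \<and> v = inv_word x @ b \<and> reduced_word (a @ b)"
  using assms
proof (induction u arbitrary: v rule: rev_induct)
  case Nil
  then show ?case by (intro exI[of _ "[]"] exI[of _ v]) simp
next
  case (snoc y u)
  show ?case
  proof (cases "reduced_word ((u @ [y]) @ v)")
    case True
    then show ?thesis by (intro exI[of _ "u @ [y]"] exI[of _ "[]"] exI[of _ v]) simp
  next
    case False
    then have "v \<noteq> []" "hd v = inv_letter y"
      using snoc.prems reduced_word_append[of "u @ [y]" v] by auto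
    then obtain v' where v: "v = inv_letter y # v'"
      by (cases v) auto
    have "reduced_word u" "reduced_word v'"
      using snoc.prems reduced_word_append[of "[inv_letter y]" v'] by (auto simp: v reduced_word_append)
    then obtain a x b where "u = a @ x" "v' = inv_word x @ b" "reduced_word (a @ b)"
      using snoc.IH by blast
    then show ?thesis
      by (intro exI[of _ a] exI[of _ "x @ [y]"] exI[of _ b]) (simp add: v)
  qed
qed

lemma reduced_word_concat_replicate:
  assumes "reduced_word (c @ c)"
  shows "reduced_word (concat (replicate n c))"
proof (induction n)
  case (Suc n)
  show ?case
  proof (cases "c = [] \<or> n = 0")
    case False
    then obtain m where "n = Suc m" by (cases n) auto
    then have "hd (concat (replicate n c)) = hd c" using False by simp
    then show ?thesis using Suc assms False by (auto simp: reduced_word_append)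
  qed (use assms in \<open>auto simp: reduced_word_append\<close>)
qed (simp add: reduced_word_def)

lemma cyclically_reduced_rotate:
  assumes "reduced_word (w @ w)"
  shows "reduced_word (rotate i w @ rotate i w)"
proof -
  define a b where "a = take (i mod length w) w" and "b = drop (i mod length w) w"
  have "w = a @ b" "rotate i w = b @ a"
    by (simp_all add: a_def b_def rotate_drop_take)
  then show ?thesis
    using assms by (cases "a = []"; cases "b = []") (auto simp: reduced_word_append)
qed

section \<open>Chains modulo powers and conjugation\<close>

lemma subspace_homogenizing_subspace: "subspace (homogenizing_subspace G)"
  by (simp add: homogenizing_subspace_def)

context group
begin

lemma gen_conj_in_homogenizing_subspace:
  assumes "g \<in> carrier G" "h \<in> carrier G"
  shows "gen (h \<otimes> g \<otimes> inv h) - gen g \<in> homogenizing_subspace G"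
proof -
  have "gen g - gen (h \<otimes> g \<otimes> inv h) \<in> homogenizing_subspace G"
    unfolding homogenizing_subspace_def using assms by (intro span_base) blast
  from subspace_neg[OF subspace_homogenizing_subspace this] show ?thesis by simp
qed

lemma gen_int_pow_in_homogenizing_subspace:
  assumes "g \<in> carrier G"
  shows "gen (g [^] (n :: int)) - of_int n *\<^sub>R gen g \<in> homogenizing_subspace G"
  unfolding homogenizing_subspace_def using assms by (intro span_base) blast

definition conj_or_inv_conj :: "'a \<Rightarrow> 'a \<Rightarrow> bool" where
  "conj_or_inv_conj a b \<longleftrightarrow>
     (\<exists>h\<in>carrier G. b = h \<otimes> a \<otimes> inv h \<or> b = h \<otimes> inv a \<otimes> inv h)"

text \<open>Conjugation does not change the class of a generator, and inversion changes its sign. As the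
  factor is its own inverse, it is the same in both directions.\<close>

lemma gen_conj_or_inv_conj:
  assumes "a \<in> carrier G" "conj_or_inv_conj a b"
  shows "\<exists>s \<in> {1, -1}. gen b - s *\<^sub>R gen a \<in> homogenizing_subspace G \<and>
    gen a - s *\<^sub>R gen b \<in> homogenizing_subspace G"
proof -
  note sub = subspace_homogenizing_subspace[of G]
  obtain h where h: "h \<in> carrier G" "b = h \<otimes> a \<otimes> inv h \<or> b = h \<otimes> inv a \<otimes> inv h"
    using assms(2) by (auto simp: conj_or_inv_conj_def)
  from h(2) show ?thesis
  proof
    assume "b = h \<otimes> a \<otimes> inv h"
    then have 1: "gen b - gen a \<in> homogenizing_subspace G"
      using gen_conj_in_homogenizing_subspace[OF assms(1) h(1)] by simp
    from subspace_neg[OF sub this] 1 show ?thesis by simp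
  next
    assume b: "b = h \<otimes> inv a \<otimes> inv h"
    have "gen b - gen (inv a) \<in> homogenizing_subspace G"
      using gen_conj_in_homogenizing_subspace[of "inv a" h] assms(1) h(1) b by simp
    moreover have "gen (inv a) - (-1) *\<^sub>R gen a \<in> homogenizing_subspace G"
      using gen_int_pow_in_homogenizing_subspace[OF assms(1), of "-1"] assms(1)
      by (simp add: int_pow_neg)
    ultimately have "(gen b - gen (inv a)) + (gen (inv a) - (-1) *\<^sub>R gen a) \<in> homogenizing_subspace G"
      by (rule subspace_add[OF sub])
    then show ?thesis by (simp add: add.commute)
  qed
qed

end

section \<open>Counting quasimorphisms on a free group\<close>

locale group_with_free_basis = group +
  fixes S
  assumes basis: "free_basis G S"
begin

lemma word_value_Nil: "word_value G [] = \<one>"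
  by (simp add: word_value_def)

lemma word_value_closed: "set w \<subseteq> S \<times> UNIV \<Longrightarrow> word_value G w \<in> carrier G"
  using subst_value_closed[OF is_group, of "\<lambda>x. x" S w] basis
  by (simp add: subst_value_def free_basis_def)

lemma word_value_append:
  "set u \<subseteq> S \<times> UNIV \<Longrightarrow> set v \<subseteq> S \<times> UNIV \<Longrightarrow>
    word_value G (u @ v) = word_value G u \<otimes> word_value G v"
  using subst_value_append[OF is_group, of "\<lambda>x. x" S u v] basis
  by (simp add: subst_value_def free_basis_def)

lemma word_value_inv_word:
  "set w \<subseteq> S \<times> UNIV \<Longrightarrow> set (inv_word w) \<subseteq> S \<times> UNIV \<and>
    word_value G (inv_word w) = inv (word_value G w)"
proof (induction w)
  case (Cons x w)
  have x: "set [x] \<subseteq> S \<times> UNIV" "set [inv_letter x] \<subseteq> S \<times> UNIV" and w: "set w \<subseteq> S \<times> UNIV"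
    using Cons.prems by (auto simp: mem_Times_iff)
  have "fst x \<in> carrier G" using x basis by (auto simp: free_basis_def mem_Times_iff)
  then have "word_value G [inv_letter x] = inv (word_value G [x])"
    by (simp add: word_value_def letter_value_def inv_letter_def)
  then have "word_value G (inv_word w @ [inv_letter x]) = inv (word_value G ([x] @ w))"
    using Cons.IH[OF w] x w
    by (simp only: word_value_append inv_mult_group word_value_closed)
  then show ?case using Cons.IH[OF w] x by auto
qed (simp add: word_value_Nil)

lemma word_value_concat_replicate:
  assumes "set c \<subseteq> S \<times> UNIV"
  shows "set (concat (replicate n c)) \<subseteq> S \<times> UNIV \<and>
    word_value G (concat (replicate n c)) = word_value G c [^] n"
proof (induction n)
  case (Suc n)
  then show ?case
    using assms nat_pow_Suc2[OF word_value_closed[OF assms], of n] by (simp add: word_value_append)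
qed (simp add: word_value_Nil)

lemma word_value_rotate:
  assumes "set w \<subseteq> S \<times> UNIV"
  shows "\<exists>h\<in>carrier G. word_value G (rotate i w) = h \<otimes> word_value G w \<otimes> inv h"
proof -
  define a b where "a = take (i mod length w) w" and "b = drop (i mod length w) w"
  have w: "w = a @ b" "rotate i w = b @ a"
    by (simp_all add: a_def b_def rotate_drop_take)
  then have ab: "set a \<subseteq> S \<times> UNIV" "set b \<subseteq> S \<times> UNIV" using assms by auto
  note closed = word_value_closed[OF ab(1)] word_value_closed[OF ab(2)]
  have "inv (word_value G a) \<otimes> (word_value G a \<otimes> (word_value G b \<otimes> word_value G a))
      = word_value G b \<otimes> word_value G a"
    using closed by (simp flip: m_assoc)
  then have "word_value G (rotate i w)
      = inv (word_value G a) \<otimes> word_value G w \<otimes> inv (inv (word_value G a))"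
    using closed by (simp add: w(2)) (simp add: w(1) word_value_append ab m_assoc)
  then show ?thesis using closed by (meson inv_closed)
qed

definition normal_form :: "'a \<Rightarrow> 'a letter list" where
  "normal_form = the_inv_into (reduced_words S) (word_value G)"

lemma normal_form:
  assumes "g \<in> carrier G"
  shows "set (normal_form g) \<subseteq> S \<times> UNIV" "reduced_word (normal_form g)"
    "word_value G (normal_form g) = g"
proof -
  have bij: "inj_on (word_value G) (reduced_words S)" "g \<in> word_value G ` reduced_words S"
    using basis assms by (auto simp: free_basis_def bij_betw_def)
  show "word_value G (normal_form g) = g"
    unfolding normal_form_def by (rule f_the_inv_into_f[OF bij])
  have "normal_form g \<in> reduced_words S"
    unfolding normal_form_def by (rule the_inv_into_into[OF bij order_refl])
  then show "set (normal_form g) \<subseteq> S \<times> UNIV" "reduced_word (normal_form g)"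
    by (auto simp: reduced_words_def)
qed

lemma normal_form_word_value:
  "set w \<subseteq> S \<times> UNIV \<Longrightarrow> reduced_word w \<Longrightarrow> normal_form (word_value G w) = w"
  unfolding normal_form_def using basis
  by (intro the_inv_into_f_f) (auto simp: free_basis_def bij_betw_def reduced_words_def)

text \<open>The tripod in the Cayley tree that is spanned by \<open>\<one>\<close>, \<open>g\<close> and \<open>g \<otimes> h\<close>: the word \<open>x\<close> is the part
  of the path that cancels in the product.\<close>

lemma normal_form_mult:
  assumes "g \<in> carrier G" "h \<in> carrier G"
  shows "\<exists>a x b. normal_form g = a @ x \<and> normal_form h = inv_word x @ b \<and>
    normal_form (g \<otimes> h) = a @ b"
proof -
  obtain a x b where eq: "normal_form g = a @ x" "normal_form h = inv_word x @ b"
      and red: "reduced_word (a @ b)"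
    using reduced_words_cancel normal_form(2)[OF assms(1)] normal_form(2)[OF assms(2)] by blast
  have sub: "set a \<subseteq> S \<times> UNIV" "set x \<subseteq> S \<times> UNIV" "set b \<subseteq> S \<times> UNIV"
    using normal_form(1)[OF assms(1)] normal_form(1)[OF assms(2)] eq by auto
  note closed = sub[THEN word_value_closed]
  have "g = word_value G a \<otimes> word_value G x"
    using normal_form(3)[OF assms(1)] sub by (simp add: eq word_value_append)
  moreover have "h = inv (word_value G x) \<otimes> word_value G b"
    using normal_form(3)[OF assms(2)] word_value_inv_word[OF sub(2)] sub
    by (simp add: eq word_value_append)
  moreover have "word_value G x \<otimes> (inv (word_value G x) \<otimes> word_value G b) = word_value G b"
    using closed by (simp flip: m_assoc)
  ultimately have "g \<otimes> h = word_value G (a @ b)"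
    using closed sub by (simp add: m_assoc word_value_append)
  then have "normal_form (g \<otimes> h) = a @ b"
    using normal_form_word_value[OF _ red] sub by simp
  with eq show ?thesis by blast
qed

definition brooks_fun :: "'a letter list \<Rightarrow> 'a \<Rightarrow> real" where
  "brooks_fun p g = of_int (brooks p (normal_form g))"

lemma defect_brooks_fun:
  assumes "reduced_word p" "unbordered p" "p \<noteq> []"
  shows "2 \<in> defect_bounds G (brooks_fun p)"
proof -
  have "\<bar>brooks_fun p (g \<otimes> h) - brooks_fun p g - brooks_fun p h\<bar> \<le> 2"
    if gh: "g \<in> carrier G" "h \<in> carrier G" for g h
  proof -
    obtain a x b where "normal_form g = a @ x" "normal_form h = inv_word x @ b"
        "normal_form (g \<otimes> h) = a @ b"
      using normal_form_mult[OF gh] by blast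
    then have "brooks_fun p (g \<otimes> h) - brooks_fun p g - brooks_fun p h
        = of_int (brooks p (a @ b) - brooks p (a @ x) - brooks p (inv_word x @ b))"
      by (simp add: brooks_fun_def)
    then show ?thesis
      using brooks_tripod[OF assms, of a b x] by linarith
  qed
  then show ?thesis by (simp add: defect_bounds_def)
qed

definition unbordered_cyclic_words :: "'a letter list set" where
  "unbordered_cyclic_words = {p. set p \<subseteq> S \<times> UNIV \<and> p \<noteq> [] \<and> reduced_word (p @ p) \<and> unbordered p}"

lemma unbordered_cyclic_wordsD:
  assumes "p \<in> unbordered_cyclic_words"
  shows "set p \<subseteq> S \<times> UNIV" "p \<noteq> []" "reduced_word (p @ p)" "unbordered p" "reduced_word p"
    "word_value G p \<in> carrier G"
  using assms by (auto simp: unbordered_cyclic_words_def reduced_word_append intro: word_value_closed)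

lemma homogenization_brooks_fun_eq:
  assumes q: "q \<in> unbordered_cyclic_words"
    and val: "\<And>n. brooks p (concat (replicate n q)) = int n * z"
  shows "homogenization G (brooks_fun p) (word_value G q) = of_int z"
proof -
  note q' = unbordered_cyclic_wordsD[OF q]
  have "brooks_fun p (word_value G q [^] n) = real n * of_int z" for n
  proof -
    have "normal_form (word_value G q [^] n) = concat (replicate n q)"
      using word_value_concat_replicate[OF q'(1), of n]
        normal_form_word_value[OF _ reduced_word_concat_replicate[OF q'(3)], of n] by simp
    then show ?thesis by (simp add: brooks_fun_def val)
  qed
  then have "\<forall>\<^sub>F n in sequentially. brooks_fun p (word_value G q [^] n) / real n = of_int z"
    by (intro eventually_sequentiallyI[of 1]) simp
  then show ?thesis
    unfolding homogenization_def by (intro limI tendsto_eventually)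
qed

lemma homogenization_brooks_fun_self:
  "p \<in> unbordered_cyclic_words \<Longrightarrow> homogenization G (brooks_fun p) (word_value G p) = 1"
  using homogenization_brooks_fun_eq[of p p 1] brooks_power_self[of p] by (simp add: unbordered_cyclic_wordsD)

lemma homogenization_brooks_fun_other:
  assumes p: "p \<in> unbordered_cyclic_words" and q: "q \<in> unbordered_cyclic_words" and len: "length q \<le> length p"
    and not_conj: "\<not> conj_or_inv_conj (word_value G q) (word_value G p)"
  shows "homogenization G (brooks_fun p) (word_value G q) = 0"
proof -
  note p' = unbordered_cyclic_wordsD[OF p] and q' = unbordered_cyclic_wordsD[OF q]
  have "p \<noteq> rotate i q" for i
    using word_value_rotate[OF q'(1), of i] not_conj by (auto simp: conj_or_inv_conj_def)
  moreover have "p \<noteq> rotate i (inv_word q)" for i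
    using word_value_rotate[of "inv_word q" i] word_value_inv_word[OF q'(1)] not_conj
    by (auto simp: conj_or_inv_conj_def)
  ultimately have "brooks p (concat (replicate n q)) = 0" for n
    using brooks_power_eq_0[OF p'(4) q'(2) len] by blast
  then show ?thesis using homogenization_brooks_fun_eq[OF q, of p 0] by simp
qed

section \<open>Integral chains in a free group\<close>

text \<open>Induction on the length of the word. If the word is not cyclically reduced, a conjugation shortens
  it. Otherwise some rotation of it, which is a conjugate, is either unbordered or a proper power
  of a shorter word.\<close>

lemma gen_equiv_multiple_of_unbordered:
  assumes "set w \<subseteq> S \<times> UNIV" "reduced_word w"
  shows "gen (word_value G w) \<in> homogenizing_subspace G \<or>
    (\<exists>p \<in> unbordered_cyclic_words. \<exists>k :: nat.
       gen (word_value G w) - real k *\<^sub>R gen (word_value G p) \<in> homogenizing_subspace G)"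
  (is "?P w")
  using assms
proof (induction w rule: length_induct)
  case (1 w)
  let ?Z = "homogenizing_subspace G"
  note add = subspace_add[OF subspace_homogenizing_subspace[of G]]
  note scale = subspace_scale[OF subspace_homogenizing_subspace[of G]]
  have sub: "set w \<subseteq> S \<times> UNIV" and red: "reduced_word w" using 1 by auto
  have transfer: "?P w" if "?P c" and "gen (word_value G w) - real k *\<^sub>R gen (word_value G c) \<in> ?Z"
    for c k
    using that(1)
  proof
    assume "gen (word_value G c) \<in> ?Z"
    from add[OF that(2) scale[OF this, of "real k"]] show ?thesis by simp
  next
    assume "\<exists>p \<in> unbordered_cyclic_words. \<exists>k :: nat. gen (word_value G c) - real k *\<^sub>R gen (word_value G p) \<in> ?Z"
    then obtain p and m :: nat where p: "p \<in> unbordered_cyclic_words"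
        "gen (word_value G c) - real m *\<^sub>R gen (word_value G p) \<in> ?Z" by blast
    from add[OF that(2) scale[OF p(2), of "real k"]]
    have "gen (word_value G w) - real (k * m) *\<^sub>R gen (word_value G p) \<in> ?Z"
      by (simp add: scaleR_diff_right)
    with p(1) show ?thesis by blast
  qed
  have rotation: "gen (word_value G w) - gen (word_value G (rotate i w)) \<in> ?Z" for i
  proof -
    obtain h where "h \<in> carrier G" "word_value G (rotate i w) = h \<otimes> word_value G w \<otimes> inv h"
      using word_value_rotate[OF sub] by blast
    then have "gen (word_value G (rotate i w)) - gen (word_value G w) \<in> ?Z"
      using gen_conj_in_homogenizing_subspace[OF word_value_closed[OF sub]] by simp
    from subspace_neg[OF subspace_homogenizing_subspace this] show ?thesis by simp
  qed
  consider "w = []" | "w \<noteq> []" "\<not> reduced_word (w @ w)" | "w \<noteq> []" "reduced_word (w @ w)"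
    by blast
  then show ?case
  proof cases
    case 1
    then show ?thesis
      using gen_int_pow_in_homogenizing_subspace[OF one_closed, of 0] by (simp add: word_value_Nil)
  next
    case 2
    then have hd: "hd w = inv_letter (last w)" using red by (auto simp: reduced_word_append)
    obtain x v where w: "w = x # v" using 2 by (cases w) auto
    have "v \<noteq> []" using hd w by auto
    then obtain u y where v: "v = u @ [y]" by (cases v rule: rev_cases) auto
    have w': "w = [x] @ u @ inv_word [x]" using hd by (simp add: w v)
    have subs: "set [x] \<subseteq> S \<times> UNIV" "set u \<subseteq> S \<times> UNIV" using sub by (auto simp: w v)
    have "reduced_word u" using red w' by (simp only: reduced_word_append)
    then have "?P u" using 1(1) subs by (simp add: w v)
    moreover have "word_value G w = word_value G [x] \<otimes> word_value G u \<otimes> inv (word_value G [x])"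
      unfolding w' using subs word_value_inv_word[OF subs(1)]
      by (simp only: word_value_append set_append Un_subset_iff simp_thms m_assoc
          word_value_closed inv_closed)
    then have "gen (word_value G w) - real 1 *\<^sub>R gen (word_value G u) \<in> ?Z"
      using gen_conj_in_homogenizing_subspace word_value_closed subs by simp
    ultimately show ?thesis by (rule transfer)
  next
    case 3
    from rotation_unbordered_or_power[OF 3(1)] show ?thesis
    proof (elim disjE exE conjE)
      fix i assume "unbordered (rotate i w)"
      then have "rotate i w \<in> unbordered_cyclic_words"
        using sub 3 cyclically_reduced_rotate[OF 3(2)] by (simp add: unbordered_cyclic_words_def)
      moreover have "gen (word_value G w) - real 1 *\<^sub>R gen (word_value G (rotate i w)) \<in> ?Z"
        using rotation[of i] by simp
      ultimately show ?thesis by blast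
    next
      fix i k c assume k: "(2::nat) \<le> k" and c: "c \<noteq> []" "rotate i w = concat (replicate k c)"
      obtain l where l: "k = Suc (Suc l)" using k by (metis Suc_le_D numeral_2_eq_2 Suc_le_mono)
      have eq: "rotate i w = c @ concat (replicate (Suc l) c)" using c(2) by (simp add: l)
      have "set (rotate i w) \<subseteq> S \<times> UNIV" using sub by simp
      then have subc: "set c \<subseteq> S \<times> UNIV" unfolding eq by simp
      have "reduced_word (rotate i w)"
        using cyclically_reduced_rotate[OF 3(2)] by (auto simp: reduced_word_append)
      then have redc: "reduced_word c" unfolding eq reduced_word_append by blast
      have "length (rotate i w) = length c + length (concat (replicate (Suc l) c))"
        unfolding eq by (rule length_append)
      then have "length c < length w" using c(1) by simp
      then have "?P c" using 1(1) subc redc by blast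
      moreover have "gen (word_value G c [^] k) - real k *\<^sub>R gen (word_value G c) \<in> ?Z"
        using gen_int_pow_in_homogenizing_subspace[OF word_value_closed[OF subc], of "int k"]
        by (simp add: int_pow_int)
      then have "gen (word_value G (rotate i w)) - real k *\<^sub>R gen (word_value G c) \<in> ?Z"
        using word_value_concat_replicate[OF subc, of k] c(2) by simp
      from add[OF rotation[of i] this]
      have "gen (word_value G w) - real k *\<^sub>R gen (word_value G c) \<in> ?Z" by simp
      ultimately show ?thesis by (rule transfer)
    qed
  qed
qed

text \<open>A finite sum of generators is equivalent to an integral combination of unbordered words no two of
  which are conjugate, even after inversion. The terms are added one by one; a new generator that
  is conjugate to an old one or to its inverse only changes the coefficient of the old one.\<close>

lemma integral_chain_normal_form:
  fixes g :: "nat \<Rightarrow> 'a"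
  assumes "\<And>i. i \<in> {1..n} \<Longrightarrow> g i \<in> carrier G"
  shows "\<exists>d. (\<Sum>i = 1..n. gen (g i)) - d \<in> homogenizing_subspace G \<and>
    Poly_Mapping.keys d \<subseteq> word_value G ` unbordered_cyclic_words \<and>
    (\<forall>a. Poly_Mapping.lookup d a \<in> \<int>) \<and>
    pairwise (\<lambda>a b. \<not> conj_or_inv_conj a b) (Poly_Mapping.keys d)"
  using assms
proof (induction n)
  case 0
  show ?case
    using subspace_0[OF subspace_homogenizing_subspace] by (intro exI[of _ 0]) simp
next
  case (Suc n)
  let ?Z = "homogenizing_subspace G" and ?R = "\<lambda>a b. \<not> conj_or_inv_conj a b"
  note add = subspace_add[OF subspace_homogenizing_subspace[of G]]
  note scale = subspace_scale[OF subspace_homogenizing_subspace[of G]]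
  obtain d where d: "(\<Sum>i = 1..n. gen (g i)) - d \<in> ?Z"
      "Poly_Mapping.keys d \<subseteq> word_value G ` unbordered_cyclic_words" "\<And>a. Poly_Mapping.lookup d a \<in> \<int>"
      "pairwise ?R (Poly_Mapping.keys d)"
    using Suc.IH Suc.prems by force
  have g: "g (Suc n) \<in> carrier G" using Suc.prems by simp
  have sum: "(\<Sum>i = 1..Suc n. gen (g i)) = (\<Sum>i = 1..n. gen (g i)) + gen (g (Suc n))" by simp
  from gen_equiv_multiple_of_unbordered[of "normal_form (g (Suc n))"] normal_form[OF g]
  have "gen (g (Suc n)) \<in> ?Z \<or>
      (\<exists>p \<in> unbordered_cyclic_words. \<exists>k :: nat. gen (g (Suc n)) - real k *\<^sub>R gen (word_value G p) \<in> ?Z)"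
    by simp
  then show ?case
  proof (elim disjE bexE exE)
    assume "gen (g (Suc n)) \<in> ?Z"
    from add[OF d(1) this] have "(\<Sum>i = 1..Suc n. gen (g i)) - d \<in> ?Z"
      unfolding sum by (simp add: algebra_simps)
    with d(2-4) show ?thesis by blast
  next
    fix p and k :: nat
    assume p: "p \<in> unbordered_cyclic_words" and k: "gen (g (Suc n)) - real k *\<^sub>R gen (word_value G p) \<in> ?Z"
    let ?q = "word_value G p"
    have "\<exists>q s. q \<in> word_value G ` unbordered_cyclic_words \<and> s \<in> {1, -1} \<and> gen ?q - s *\<^sub>R gen q \<in> ?Z \<and>
        pairwise ?R (insert q (Poly_Mapping.keys d))"
    proof (cases "\<exists>b \<in> Poly_Mapping.keys d. conj_or_inv_conj b ?q \<or> conj_or_inv_conj ?q b")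
      case True
      then obtain b where b: "b \<in> Poly_Mapping.keys d"
          "conj_or_inv_conj b ?q \<or> conj_or_inv_conj ?q b" by blast
      then have "b \<in> word_value G ` unbordered_cyclic_words" using d(2) by blast
      moreover have "\<exists>s \<in> {1, -1}. gen ?q - s *\<^sub>R gen b \<in> ?Z"
        using b(2) gen_conj_or_inv_conj unbordered_cyclic_wordsD(6) p \<open>b \<in> word_value G ` unbordered_cyclic_words\<close>
        by blast
      ultimately show ?thesis
        using d(4) b(1) by (metis insert_absorb)
    next
      case False
      then have "pairwise ?R (insert ?q (Poly_Mapping.keys d))"
        using d(4) by (auto simp: pairwise_insert)
      moreover have "gen ?q - 1 *\<^sub>R gen ?q \<in> ?Z"
        using subspace_0[OF subspace_homogenizing_subspace] by simp
      ultimately show ?thesis using p by blast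
    qed
    then obtain q s where q: "q \<in> word_value G ` unbordered_cyclic_words" "s \<in> {1, -1}"
        "gen ?q - s *\<^sub>R gen q \<in> ?Z" "pairwise ?R (insert q (Poly_Mapping.keys d))"
      by blast
    define d' where "d' = d + (real k * s) *\<^sub>R gen q"
    have lookup: "Poly_Mapping.lookup d' a
        = Poly_Mapping.lookup d a + (if a = q then real k * s else 0)" for a
      by (simp add: d'_def lookup_add lookup_scaleR_real gen_def lookup_single when_def)
    have "(\<Sum>i = 1..Suc n. gen (g i)) - d' \<in> ?Z"
      using add[OF add[OF d(1) k] scale[OF q(3), of "real k"]]
      unfolding sum d'_def by (simp add: algebra_simps)
    moreover have keys: "Poly_Mapping.keys d' \<subseteq> insert q (Poly_Mapping.keys d)"
      by (auto simp: in_keys_iff lookup split: if_splits)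
    moreover have "Poly_Mapping.lookup d' a \<in> \<int>" for a
      using d(3)[of a] q(2) by (auto simp: lookup)
    moreover have "pairwise ?R (Poly_Mapping.keys d')"
      using q(4) keys by (rule pairwise_subset)
    ultimately show ?thesis
      using d(2) q(1) by (intro exI[of _ d']) blast
  qed
qed

text \<open>Among the words of the normal form of the chain, count a longest one, \<open>p\<close>. All others are
  at most as long and not conjugate to \<open>p\<close> or its inverse, hence invisible, and the value on the chain is the
  coefficient of \<open>p\<close>, a nonzero integer.\<close>

lemma nonzero_chain_detected:
  fixes g :: "nat \<Rightarrow> 'a"
  assumes g: "\<And>i. i \<in> {1..n} \<Longrightarrow> g i \<in> carrier G"
    and nonzero: "(\<Sum>i = 1..n. gen (g i)) \<notin> homogenizing_subspace G"
  shows "\<exists>\<psi>. homogeneous_quasimorphism G \<psi> \<and> 4 \<in> defect_bounds G \<psi> \<and>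
    \<bar>chain_eval \<psi> (\<Sum>i = 1..n. gen (g i))\<bar> \<ge> 1"
proof -
  let ?c = "\<Sum>i = 1..n. gen (g i)"
  obtain d where d: "?c - d \<in> homogenizing_subspace G"
      "Poly_Mapping.keys d \<subseteq> word_value G ` unbordered_cyclic_words" "\<And>a. Poly_Mapping.lookup d a \<in> \<int>"
      "pairwise (\<lambda>a b. \<not> conj_or_inv_conj a b) (Poly_Mapping.keys d)"
    using integral_chain_normal_form[of n g] g by blast
  have "Poly_Mapping.keys d \<noteq> {}"
    using d(1) nonzero by auto
  then obtain a where a: "a \<in> Poly_Mapping.keys d"
      "\<And>b. b \<in> Poly_Mapping.keys d \<Longrightarrow> length (normal_form b) \<le> length (normal_form a)"
    using obtains_MAX[of "Poly_Mapping.keys d" "\<lambda>b. length (normal_form b)"]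
    by (metis Max_ge finite_imageI finite_keys imageI)
  obtain p where p: "p \<in> unbordered_cyclic_words" "a = word_value G p"
    using a(1) d(2) by blast
  define \<psi> where "\<psi> = homogenization G (brooks_fun p)"
  have D: "2 \<in> defect_bounds G (brooks_fun p)"
    using p(1) by (intro defect_brooks_fun) (simp_all add: unbordered_cyclic_wordsD)
  have hom: "homogeneous_quasimorphism G \<psi>"
    unfolding \<psi>_def by (rule homogeneous_quasimorphism_homogenization[OF D])
  have other: "\<psi> b = 0" if b: "b \<in> Poly_Mapping.keys d - {a}" for b
  proof -
    obtain q where q: "q \<in> unbordered_cyclic_words" "b = word_value G q" using b d(2) by blast
    have "length q \<le> length p"
      using a(2)[of b] b p q by (simp add: normal_form_word_value unbordered_cyclic_wordsD)
    moreover have "\<not> conj_or_inv_conj b a"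
      using d(4) a(1) b by (auto simp: pairwise_def)
    ultimately show ?thesis
      unfolding \<psi>_def using homogenization_brooks_fun_other p q by simp
  qed
  have "chain_eval \<psi> ?c = chain_eval \<psi> d"
    using chain_eval_homogenizing_subspace[OF is_group hom d(1)]
    by (simp add: linear_diff[OF linear_chain_eval])
  also have "\<dots> = Poly_Mapping.lookup d a * \<psi> a
      + (\<Sum>b \<in> Poly_Mapping.keys d - {a}. Poly_Mapping.lookup d b * \<psi> b)"
    unfolding chain_eval_def by (rule sum.remove) (use a(1) in auto)
  also have "\<dots> = Poly_Mapping.lookup d a"
    using other homogenization_brooks_fun_self[OF p(1)] by (simp add: \<psi>_def p(2))
  finally have "chain_eval \<psi> ?c = Poly_Mapping.lookup d a" .
  moreover have "\<bar>Poly_Mapping.lookup d a\<bar> \<ge> 1"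
    using d(3)[of a] a(1) by (intro Ints_nonzero_abs_ge1) (auto simp: in_keys_iff)
  moreover have "4 \<in> defect_bounds G \<psi>"
    using defect_homogenization[OF D] by (simp add: \<psi>_def)
  ultimately show ?thesis using hom by auto
qed

end

section \<open>The lower bound on stable commutator length\<close>

text \<open>A function of defect \<open>0\<close> is a homomorphism and vanishes on boundaries. So a quasimorphism that
  does not vanish on a boundary takes part in the supremum that defines \<open>scl\<close>.\<close>

lemma chain_eval_boundary_eq_0:
  assumes "c \<in> B1 G" "quasimorphism G \<phi>" "defect G \<phi> \<le> 0"
  shows "chain_eval \<phi> c = 0"
proof -
  obtain d where d: "Poly_Mapping.keys d \<subseteq> carrier G \<times> carrier G" "c = bar_boundary G d"
    using assms(1) by (auto simp: B1_def C2_def free_vs_def)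
  have "chain_eval \<phi> c = (\<Sum>(g, h) \<in> Poly_Mapping.keys d.
      Poly_Mapping.lookup d (g, h) * (\<phi> g - \<phi> (g \<otimes>\<^bsub>G\<^esub> h) + \<phi> h))"
    unfolding d(2) bar_boundary_def
    by (simp add: linear_sum[OF linear_chain_eval] case_prod_unfold chain_eval_scaleR
        chain_eval_add linear_diff[OF linear_chain_eval] chain_eval_gen)
  also have "\<dots> = 0"
  proof (rule sum.neutral, clarify)
    fix g h assume "(g, h) \<in> Poly_Mapping.keys d"
    then have "\<bar>\<phi> (g \<otimes>\<^bsub>G\<^esub> h) - \<phi> g - \<phi> h\<bar> \<le> 0"
      using d(1) assms(3) defect_bound[OF assms(2), of g h] by fastforce
    then show "Poly_Mapping.lookup d (g, h) * (\<phi> g - \<phi> (g \<otimes>\<^bsub>G\<^esub> h) + \<phi> h) = 0"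
      by simp
  qed
  finally show ?thesis .
qed

text \<open>The absolute value is allowed because the negative of a homogeneous quasimorphism is one of the
  same defect.\<close>

lemma scl_lower_bound:
  assumes c: "c \<in> B1 G" and \<psi>: "homogeneous_quasimorphism G \<psi>" and D: "D \<in> defect_bounds G \<psi>"
    and nonzero: "chain_eval \<psi> c \<noteq> 0"
  shows "\<bar>chain_eval \<psi> c\<bar> / (2 * D) \<le> scl G c"
proof -
  define s where "s = sgn (chain_eval \<psi> c)"
  have s: "\<bar>s\<bar> = 1" using nonzero by (simp add: s_def abs_sgn_eq)
  define \<chi> where "\<chi> = (\<lambda>g. s * \<psi> g)"
  have "\<bar>s * x - s * y - s * z\<bar> = \<bar>x - y - z\<bar>" for x y z
    using s by (simp add: abs_mult flip: right_diff_distrib)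
  then have bounds: "defect_bounds G \<chi> = defect_bounds G \<psi>"
    by (simp add: defect_bounds_def \<chi>_def)
  have \<chi>: "homogeneous_quasimorphism G \<chi>"
    using \<psi> unfolding homogeneous_quasimorphism_def quasimorphism_def bounds by (simp add: \<chi>_def)
  have eval: "chain_eval \<chi> c = \<bar>chain_eval \<psi> c\<bar>"
  proof -
    have "chain_eval \<chi> c = s * chain_eval \<psi> c"
      by (simp add: chain_eval_def \<chi>_def sum_distrib_left mult_ac)
    then show ?thesis by (simp add: s_def abs_sgn mult.commute)
  qed
  have pos: "defect G \<chi> > 0"
    using chain_eval_boundary_eq_0[OF c, of \<chi>] \<chi> eval nonzero
    by (force simp: homogeneous_quasimorphism_def)
  have "defect G \<chi> \<le> D"
    unfolding defect_def bounds
    by (rule cInf_lower[OF D]) (auto simp: defect_bounds_def intro!: bdd_belowI[of _ 0])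
  then have "\<bar>chain_eval \<psi> c\<bar> / (2 * D) \<le> chain_eval \<chi> c / (2 * defect G \<chi>)"
    unfolding eval using pos by (intro divide_left_mono) auto
  also have "\<dots> \<le> (SUP \<phi> \<in> {\<phi>. homogeneous_quasimorphism G \<phi> \<and> defect G \<phi> > 0}.
      chain_eval \<phi> c / (2 * defect G \<phi>))"
    by (rule cSUP_upper[OF _ bdd_above_scl[OF c]]) (simp add: \<chi> pos)
  also have "\<dots> = scl G c"
    using \<chi> pos by (auto simp: scl_def)
  finally show ?thesis .
qed

lemma scl_0: "scl G 0 = 0"
  by (simp add: scl_def chain_eval_zero)

lemma C1bar_class_eq_0_iff: "C1bar_class G c = C1bar_class G 0 \<longleftrightarrow> c \<in> homogenizing_subspace G"
proof
  assume "C1bar_class G c = C1bar_class G 0"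
  moreover have "c + 0 \<in> C1bar_class G c"
    unfolding C1bar_class_def by (intro imageI subspace_0[OF subspace_homogenizing_subspace])
  ultimately show "c \<in> homogenizing_subspace G" by (auto simp: C1bar_class_def)
next
  assume c: "c \<in> homogenizing_subspace G"
  have "x \<in> (+) c ` homogenizing_subspace G" if "x \<in> homogenizing_subspace G" for x
    using subspace_diff[OF subspace_homogenizing_subspace that c] by (intro image_eqI[of _ _ "x - c"]) auto
  then show "C1bar_class G c = C1bar_class G 0"
    using subspace_add[OF subspace_homogenizing_subspace c] by (auto simp: C1bar_class_def)
qed

theorem theorem1p1:
  fixes F :: "('a, 'm) monoid_scheme" and g :: "nat \<Rightarrow> 'a" and n :: nat
  assumes "free_group F"
    and "\<And>i. i \<in> {1..n} \<Longrightarrow> g i \<in> carrier F"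
    and "(\<Sum>i = 1..n. gen (g i)) \<in> B1 F"
  shows "(C1bar_class F (\<Sum>i = 1..n. gen (g i)) = C1bar_class F 0 \<and>
            scl F (\<Sum>i = 1..n. gen (g i)) = 0) \<or>
         (C1bar_class F (\<Sum>i = 1..n. gen (g i)) \<noteq> C1bar_class F 0 \<and>
            scl F (\<Sum>i = 1..n. gen (g i)) \<ge> 1 / 8)"
proof -
  let ?c = "\<Sum>i = 1..n. gen (g i)"
  obtain S where F: "group F" "free_basis F S"
    using assms(1) by (auto simp: free_group_def)
  interpret group_with_free_basis F S
    using F by (simp add: group_with_free_basis_def group_with_free_basis_axioms_def)
  show ?thesis
  proof (cases "?c \<in> homogenizing_subspace F")
    case True
    then have "C1bar_class F ?c = C1bar_class F 0" by (simp add: C1bar_class_eq_0_iff)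
    with scl_C1bar_class[OF F(1) this] show ?thesis by (simp add: scl_0)
  next
    case False
    then obtain \<psi> where \<psi>: "homogeneous_quasimorphism F \<psi>" "4 \<in> defect_bounds F \<psi>"
        "\<bar>chain_eval \<psi> ?c\<bar> \<ge> 1"
      using nonzero_chain_detected[of n g] assms(2) by blast
    have "1 / 8 \<le> \<bar>chain_eval \<psi> ?c\<bar> / (2 * 4)"
      using \<psi>(3) by simp
    also have "\<dots> \<le> scl F ?c"
      using scl_lower_bound[OF assms(3) \<psi>(1,2)] \<psi>(3) by auto
    finally show ?thesis using False by (simp add: C1bar_class_eq_0_iff)
  qed
qed

end
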